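(* If $X$ is a real Banach space of dimension at least three (possibly infinite), then $X$ does not have the $2$-summing property. Consequently, up to isometric isomorphism, the only real Banach spaces which have the $2$-summing property are $\mathbb{R}$ and real $\ell_\infty^2$.
   Context: Scalars are real and operators are bounded and linear. Banach spaces are assumed nonzero. For an operator $T:X\to Y$ between Banach spaces, the $2$-summing norm is $\pi_2(T)=\sup\big(\sum_{i=1}^n\|TUe_i\|^2\big)^{1/2}\in[0,\infty]$, the supremum over all $n\ge 1$ and all operators $U:\ell_2^n\to X$ with $\|U\|\le 1$, where $(e_i)$ is the unit vector basis of $\ell_2^n$. A Banach space $X$ has the $2$-summing property if $\pi_2(T)=\|T\|$ for every operator $T:X\to\ell_2$. *)

theory Defs
  imports "HOL-Analysis.Analysis"
begin

section \<open>The Hilbert space of square-summable real sequences\<close>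

typedef ell2 = "{x :: nat \<Rightarrow> real. summable (\<lambda>i. (x i)\<^sup>2)}"
  morphisms coord Abs_ell2
  by (intro exI[of _ "\<lambda>_. 0"]) simp

setup_lifting type_definition_ell2

lemma summable_coord_sq: "summable (\<lambda>i. (coord x i)\<^sup>2)"
  using coord[of x] by simp

lemma summable_mult_of_sq:
  fixes x y :: "nat \<Rightarrow> real"
  assumes "summable (\<lambda>i. (x i)\<^sup>2)" "summable (\<lambda>i. (y i)\<^sup>2)"
  shows "summable (\<lambda>i. x i * y i)"
proof (rule summable_comparison_test')
  show "summable (\<lambda>i. (x i)\<^sup>2 + (y i)\<^sup>2)"
    using assms by (rule summable_add)
  fix i
  have "0 \<le> (\<bar>x i\<bar> - \<bar>y i\<bar>)\<^sup>2" by simp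
  then have "2 * (\<bar>x i\<bar> * \<bar>y i\<bar>) \<le> (x i)\<^sup>2 + (y i)\<^sup>2"
    by (simp add: power2_diff)
  moreover have "0 \<le> \<bar>x i\<bar> * \<bar>y i\<bar>" by simp
  ultimately show "norm (x i * y i) \<le> (x i)\<^sup>2 + (y i)\<^sup>2"
    unfolding real_norm_def abs_mult by linarith
qed

lemma summable_sq_add:
  fixes x y :: "nat \<Rightarrow> real"
  assumes "summable (\<lambda>i. (x i)\<^sup>2)" "summable (\<lambda>i. (y i)\<^sup>2)"
  shows "summable (\<lambda>i. (x i + y i)\<^sup>2)"
proof -
  have "summable (\<lambda>i. (x i)\<^sup>2 + (y i)\<^sup>2 + 2 * (x i * y i))"
    by (intro summable_add summable_mult summable_mult_of_sq assms)
  then show ?thesis by (simp add: power2_sum mult.assoc)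
qed

lemma summable_sq_scale:
  fixes x :: "nat \<Rightarrow> real"
  assumes "summable (\<lambda>i. (x i)\<^sup>2)"
  shows "summable (\<lambda>i. (c * x i)\<^sup>2)"
  using summable_mult[OF assms, of "c\<^sup>2"] by (simp add: power_mult_distrib)

instantiation ell2 :: real_vector
begin

lift_definition zero_ell2 :: ell2 is "\<lambda>_. 0" by simp

lift_definition plus_ell2 :: "ell2 \<Rightarrow> ell2 \<Rightarrow> ell2" is "\<lambda>x y i. x i + y i"
  by (rule summable_sq_add)

lift_definition uminus_ell2 :: "ell2 \<Rightarrow> ell2" is "\<lambda>x i. - x i" by simp

lift_definition minus_ell2 :: "ell2 \<Rightarrow> ell2 \<Rightarrow> ell2" is "\<lambda>x y i. x i - y i"
  subgoal for x y using summable_sq_add[of x "\<lambda>i. - y i"] by simp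
  done

lift_definition scaleR_ell2 :: "real \<Rightarrow> ell2 \<Rightarrow> ell2" is "\<lambda>c x i. c * x i"
  by (rule summable_sq_scale)

instance
proof
  fix x y z :: ell2 and a b :: real
  show "x + y + z = x + (y + z)" by transfer (simp add: add.assoc)
  show "x + y = y + x" by transfer (simp add: add.commute)
  show "0 + x = x" by transfer simp
  show "- x + x = 0" by transfer simp
  show "x - y = x + - y" by transfer simp
  show "a *\<^sub>R (x + y) = a *\<^sub>R x + a *\<^sub>R y" by transfer (simp add: algebra_simps)
  show "(a + b) *\<^sub>R x = a *\<^sub>R x + b *\<^sub>R x" by transfer (simp add: algebra_simps)
  show "a *\<^sub>R b *\<^sub>R x = (a * b) *\<^sub>R x" by transfer (simp add: mult.assoc)
  show "1 *\<^sub>R x = x" by transfer simp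
qed

end

instantiation ell2 :: real_inner
begin

definition inner_ell2 :: "ell2 \<Rightarrow> ell2 \<Rightarrow> real"
  where "inner_ell2 x y = (\<Sum>i. coord x i * coord y i)"

definition norm_ell2 :: "ell2 \<Rightarrow> real"
  where "norm_ell2 x = sqrt (\<Sum>i. (coord x i)\<^sup>2)"

definition sgn_ell2 :: "ell2 \<Rightarrow> ell2"
  where "sgn_ell2 x = x /\<^sub>R norm x"

definition dist_ell2 :: "ell2 \<Rightarrow> ell2 \<Rightarrow> real"
  where "dist_ell2 x y = norm (x - y)"

definition uniformity_ell2 :: "(ell2 \<times> ell2) filter"
  where "uniformity_ell2 = (INF e\<in>{0<..}. principal {(x, y). dist x y < e})"

definition open_ell2 :: "ell2 set \<Rightarrow> bool"
  where "open_ell2 U \<longleftrightarrow> (\<forall>x\<in>U. eventually (\<lambda>(x', y). x' = x \<longrightarrow> y \<in> U) uniformity)"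

instance
proof
  fix x y z :: ell2 and a b :: real
  have sm: "summable (\<lambda>i. coord u i * coord v i)" for u v
    by (intro summable_mult_of_sq summable_coord_sq)
  show "dist x y = norm (x - y)" by (rule dist_ell2_def)
  show "sgn x = x /\<^sub>R norm x" by (rule sgn_ell2_def)
  show "uniformity = (INF e\<in>{0<..}. principal {(x :: ell2, y). dist x y < e})"
    by (rule uniformity_ell2_def)
  show "open U \<longleftrightarrow> (\<forall>x\<in>U. eventually (\<lambda>(x', y). x' = x \<longrightarrow> y \<in> U) uniformity)"
    for U :: "ell2 set" by (rule open_ell2_def)
  show "x \<bullet> y = y \<bullet> x" by (simp add: inner_ell2_def mult.commute)
  show "(x + y) \<bullet> z = x \<bullet> z + y \<bullet> z"
    using suminf_add[OF sm sm, of x z y z]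
    by (simp add: inner_ell2_def plus_ell2.rep_eq distrib_right)
  show "a *\<^sub>R x \<bullet> y = a * (x \<bullet> y)"
    using suminf_mult[OF sm, of a x y]
    by (simp add: inner_ell2_def scaleR_ell2.rep_eq mult.assoc)
  show "0 \<le> x \<bullet> x"
    unfolding inner_ell2_def by (intro suminf_nonneg sm) simp
  show "x \<bullet> x = 0 \<longleftrightarrow> x = 0"
    using suminf_eq_zero_iff[OF sm, of x x]
    by (auto simp: inner_ell2_def coord_inject[symmetric] zero_ell2.rep_eq fun_eq_iff)
  show "norm x = sqrt (x \<bullet> x)"
    by (simp add: norm_ell2_def inner_ell2_def power2_eq_square)
qed

end

lemma abs_coord_le_norm: "\<bar>coord x i\<bar> \<le> norm x"
proof -
  have "(coord x i)\<^sup>2 = (\<Sum>j\<in>{i}. (coord x j)\<^sup>2)" by simp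
  also have "\<dots> \<le> (\<Sum>j. (coord x j)\<^sup>2)"
    by (intro sum_le_suminf summable_coord_sq) auto
  finally have "sqrt ((coord x i)\<^sup>2) \<le> norm x"
    unfolding norm_ell2_def by (rule real_sqrt_le_mono)
  then show ?thesis by simp
qed

lemma partial_sum_le_norm_sq: "(\<Sum>i<k. (coord x i)\<^sup>2) \<le> (norm x)\<^sup>2"
proof -
  have "0 \<le> (\<Sum>i. (coord x i)\<^sup>2)"
    by (intro suminf_nonneg summable_coord_sq) simp
  moreover have "(\<Sum>i<k. (coord x i)\<^sup>2) \<le> (\<Sum>i. (coord x i)\<^sup>2)"
    by (intro sum_le_suminf summable_coord_sq) auto
  ultimately show ?thesis by (simp add: norm_ell2_def)
qed

instance ell2 :: banach
proof
  fix X :: "nat \<Rightarrow> ell2"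
  assume X: "Cauchy X"
  have "Cauchy (\<lambda>n. coord (X n) i)" for i
  proof (rule metric_CauchyI)
    fix e :: real assume "0 < e"
    then obtain N where N: "\<And>m n. m \<ge> N \<Longrightarrow> n \<ge> N \<Longrightarrow> dist (X m) (X n) < e"
      using metric_CauchyD[OF X] by blast
    have "dist (coord (X m) i) (coord (X n) i) < e" if "m \<ge> N" "n \<ge> N" for m n
      using abs_coord_le_norm[of "X m - X n" i] N[OF that]
      by (simp add: dist_norm minus_ell2.rep_eq)
    then show "\<exists>N. \<forall>m\<ge>N. \<forall>n\<ge>N. dist (coord (X m) i) (coord (X n) i) < e" by blast
  qed
  then have "\<exists>l. (\<lambda>n. coord (X n) i) \<longlonglongrightarrow> l" for i
    by (simp add: Cauchy_convergent_iff convergent_def)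
  then obtain l where l: "\<And>i. (\<lambda>n. coord (X n) i) \<longlonglongrightarrow> l i" by metis
  have tail: "\<exists>N. \<forall>m\<ge>N. \<forall>k. (\<Sum>i<k. (coord (X m) i - l i)\<^sup>2) \<le> e\<^sup>2" if e: "e > 0" for e :: real
  proof -
    obtain N where N: "\<And>m n. m \<ge> N \<Longrightarrow> n \<ge> N \<Longrightarrow> dist (X m) (X n) < e"
      using metric_CauchyD[OF X e] by blast
    have "(\<Sum>i<k. (coord (X m) i - l i)\<^sup>2) \<le> e\<^sup>2" if m: "m \<ge> N" for m k
    proof (rule LIMSEQ_le_const2)
      show "(\<lambda>n. \<Sum>i<k. (coord (X m) i - coord (X n) i)\<^sup>2) \<longlonglongrightarrow> (\<Sum>i<k. (coord (X m) i - l i)\<^sup>2)"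
        by (intro tendsto_intros l)
      have "(\<Sum>i<k. (coord (X m) i - coord (X n) i)\<^sup>2) \<le> e\<^sup>2" if "n \<ge> N" for n
      proof -
        have "norm (X m - X n) \<le> e" using N[OF m that] by (simp add: dist_norm)
        then have "(norm (X m - X n))\<^sup>2 \<le> e\<^sup>2" by (intro power_mono) auto
        then show ?thesis
          using partial_sum_le_norm_sq[of "X m - X n" k] by (simp add: minus_ell2.rep_eq)
      qed
      then show "\<exists>N. \<forall>n\<ge>N. (\<Sum>i<k. (coord (X m) i - coord (X n) i)\<^sup>2) \<le> e\<^sup>2" by blast
    qed
    then show ?thesis by blast
  qed
  have summ: "summable (\<lambda>i. (coord (X m) i - l i)\<^sup>2)"
    if "\<forall>k. (\<Sum>i<k. (coord (X m) i - l i)\<^sup>2) \<le> B" for m B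
    using that by (intro summableI_nonneg_bounded[of _ B]) auto
  obtain M where M: "\<forall>m\<ge>M. \<forall>k. (\<Sum>i<k. (coord (X m) i - l i)\<^sup>2) \<le> 1\<^sup>2"
    using tail[of 1] by auto
  have "summable (\<lambda>i. (coord (X M) i - l i)\<^sup>2)"
    by (rule summ[of M "1\<^sup>2"]) (use M in blast)
  then have "summable (\<lambda>i. (- 1 * (coord (X M) i - l i))\<^sup>2)"
    by (rule summable_sq_scale)
  from summable_sq_add[OF summable_coord_sq[of "X M"] this] have sl: "summable (\<lambda>i. (l i)\<^sup>2)" by simp
  define L where "L = Abs_ell2 l"
  have cL: "coord L = l" unfolding L_def using sl by (simp add: Abs_ell2_inverse)
  have "X \<longlonglongrightarrow> L"
  proof (rule metric_LIMSEQ_I)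
    fix r :: real assume r: "0 < r"
    then obtain N where N: "\<forall>m\<ge>N. \<forall>k. (\<Sum>i<k. (coord (X m) i - l i)\<^sup>2) \<le> (r/2)\<^sup>2"
      using tail[of "r/2"] by auto
    have "dist (X m) L < r" if m: "m \<ge> N" for m
    proof -
      have "(\<Sum>i. (coord (X m) i - l i)\<^sup>2) \<le> (r/2)\<^sup>2"
      proof (rule suminf_le_const)
        show "summable (\<lambda>i. (coord (X m) i - l i)\<^sup>2)"
          by (rule summ[of m "(r/2)\<^sup>2"]) (use N m in blast)
      qed (use N m in blast)
      then have "sqrt (\<Sum>i. (coord (X m) i - l i)\<^sup>2) \<le> sqrt ((r/2)\<^sup>2)"
        by (rule real_sqrt_le_mono)
      also have "\<dots> = r/2" using r by (intro real_sqrt_unique) auto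
      finally have "norm (X m - L) \<le> r/2"
        by (simp only: norm_ell2_def minus_ell2.rep_eq cL)
      then show ?thesis using r by (simp add: dist_norm)
    qed
    then show "\<exists>N. \<forall>m\<ge>N. dist (X m) L < r" by blast
  qed
  then show "convergent X" by (rule convergentI)
qed

lift_definition ell2_unit :: "nat \<Rightarrow> ell2" is "\<lambda>k i. if i = k then 1 else 0"
  subgoal for k by (intro summable_finite[of "{k}"]) auto
  done

section \<open>The plane with the maximum norm\<close>

typedef linf2 = "UNIV :: (real \<times> real) set"
  morphisms pair_of_linf2 Abs_linf2
  by simp

setup_lifting type_definition_linf2

instantiation linf2 :: real_vector
begin

lift_definition zero_linf2 :: linf2 is "0" .

lift_definition plus_linf2 :: "linf2 \<Rightarrow> linf2 \<Rightarrow> linf2" is "(+)" .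

lift_definition uminus_linf2 :: "linf2 \<Rightarrow> linf2" is "uminus" .

lift_definition minus_linf2 :: "linf2 \<Rightarrow> linf2 \<Rightarrow> linf2" is "(-)" .

lift_definition scaleR_linf2 :: "real \<Rightarrow> linf2 \<Rightarrow> linf2" is "scaleR" .

instance
proof
  fix x y z :: linf2 and a b :: real
  show "x + y + z = x + (y + z)" by transfer (simp add: add.assoc)
  show "x + y = y + x" by transfer (simp add: add.commute)
  show "0 + x = x" by transfer simp
  show "- x + x = 0" by transfer simp
  show "x - y = x + - y" by transfer simp
  show "a *\<^sub>R (x + y) = a *\<^sub>R x + a *\<^sub>R y" by transfer (simp add: scaleR_add_right)
  show "(a + b) *\<^sub>R x = a *\<^sub>R x + b *\<^sub>R x" by transfer (simp add: scaleR_add_left)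
  show "a *\<^sub>R b *\<^sub>R x = (a * b) *\<^sub>R x" by transfer simp
  show "1 *\<^sub>R x = x" by transfer simp
qed

end

instantiation linf2 :: real_normed_vector
begin

lift_definition norm_linf2 :: "linf2 \<Rightarrow> real" is "\<lambda>(a, b). max \<bar>a\<bar> \<bar>b\<bar>" .

definition sgn_linf2 :: "linf2 \<Rightarrow> linf2"
  where "sgn_linf2 x = x /\<^sub>R norm x"

definition dist_linf2 :: "linf2 \<Rightarrow> linf2 \<Rightarrow> real"
  where "dist_linf2 x y = norm (x - y)"

definition uniformity_linf2 :: "(linf2 \<times> linf2) filter"
  where "uniformity_linf2 = (INF e\<in>{0<..}. principal {(x, y). dist x y < e})"

definition open_linf2 :: "linf2 set \<Rightarrow> bool"
  where "open_linf2 U \<longleftrightarrow> (\<forall>x\<in>U. eventually (\<lambda>(x', y). x' = x \<longrightarrow> y \<in> U) uniformity)"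

instance
proof
  fix x y z :: linf2 and a b :: real
  show "dist x y = norm (x - y)" by (rule dist_linf2_def)
  show "sgn x = x /\<^sub>R norm x" by (rule sgn_linf2_def)
  show "uniformity = (INF e\<in>{0<..}. principal {(x :: linf2, y). dist x y < e})"
    by (rule uniformity_linf2_def)
  show "open U \<longleftrightarrow> (\<forall>x\<in>U. eventually (\<lambda>(x', y). x' = x \<longrightarrow> y \<in> U) uniformity)"
    for U :: "linf2 set" by (rule open_linf2_def)
  show "norm x = 0 \<longleftrightarrow> x = 0" 
    by transfer (auto simp: max_def zero_prod_def split: if_splits)
  show "norm (x + y) \<le> norm x + norm y"
    by transfer (clarsimp, intro conjI max.boundedI; linarith)
  show "norm (a *\<^sub>R x) = \<bar>a\<bar> * norm x"
    
  proof transfer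
    show "(case a *\<^sub>R p of (u, v) \<Rightarrow> max \<bar>u\<bar> \<bar>v\<bar>) = \<bar>a\<bar> * (case p of (u, v) \<Rightarrow> max \<bar>u\<bar> \<bar>v\<bar>)"
      for a :: real and p :: "real \<times> real"
      by (cases p) (simp add: abs_mult max_def mult_left_mono order_antisym)
  qed
qed

end

lemma norm_linf2_fst: "\<bar>fst (pair_of_linf2 x)\<bar> \<le> norm x"
  and norm_linf2_snd: "\<bar>snd (pair_of_linf2 x)\<bar> \<le> norm x"
  by (transfer; auto)+

instance linf2 :: banach
proof
  fix X :: "nat \<Rightarrow> linf2"
  assume X: "Cauchy X"
  let ?f = "\<lambda>n. fst (pair_of_linf2 (X n))" and ?s = "\<lambda>n. snd (pair_of_linf2 (X n))"
  have le: "dist (?f m) (?f n) \<le> dist (X m) (X n)" "dist (?s m) (?s n) \<le> dist (X m) (X n)" for m n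
    using norm_linf2_fst[of "X m - X n"] norm_linf2_snd[of "X m - X n"]
    by (simp_all add: dist_norm minus_linf2.rep_eq)
  have Cauchy_mono: "Cauchy g" if "\<And>m n. dist (g m) (g n) \<le> dist (X m) (X n)" for g :: "nat \<Rightarrow> real"
  proof (rule metric_CauchyI)
    fix e :: real assume "0 < e"
    then obtain N where "\<And>m n. m \<ge> N \<Longrightarrow> n \<ge> N \<Longrightarrow> dist (X m) (X n) < e"
      using metric_CauchyD[OF X] by blast
    then show "\<exists>N. \<forall>m\<ge>N. \<forall>n\<ge>N. dist (g m) (g n) < e"
      using that order_le_less_trans by blast
  qed
  have "Cauchy ?f" "Cauchy ?s"
    by (rule Cauchy_mono[OF le(1)], rule Cauchy_mono[OF le(2)])
  then obtain a b where ab: "?f \<longlonglongrightarrow> a" "?s \<longlonglongrightarrow> b"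
    unfolding Cauchy_convergent_iff convergent_def by blast
  have "norm (X n - Abs_linf2 (a, b)) \<le> \<bar>?f n - a\<bar> + \<bar>?s n - b\<bar>" for n
    by (simp add: norm_linf2.rep_eq minus_linf2.rep_eq Abs_linf2_inverse case_prod_beta)
  moreover have "(\<lambda>n. \<bar>?f n - a\<bar> + \<bar>?s n - b\<bar>) \<longlonglongrightarrow> 0"
    using tendsto_add[OF tendsto_rabs[OF LIM_zero[OF ab(1)]] tendsto_rabs[OF LIM_zero[OF ab(2)]]]
    by simp
  ultimately have "(\<lambda>n. X n - Abs_linf2 (a, b)) \<longlonglongrightarrow> 0"
    by (rule Lim_null_comparison[OF always_eventually[OF allI]])
  then have "X \<longlonglongrightarrow> Abs_linf2 (a, b)" by (rule LIM_zero_cancel)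
  then show "convergent X" by (rule convergentI)
qed

section \<open>Two-summing operators\<close>

text \<open>Since \<open>n\<close> is bound inside the supremum below, the Euclidean space of dimension \<open>n\<close>
  is taken as the subspace of \<^typ>\<open>ell2\<close> of sequences supported on the first \<open>n\<close>
  coordinates, instead of a type depending on \<open>n\<close>.\<close>

definition ell2_fin :: "nat \<Rightarrow> ell2 set"
  where "ell2_fin n = {x. \<forall>i\<ge>n. coord x i = 0}"

text \<open>Linear maps of norm at most one on a subspace; values outside \<open>S\<close> are irrelevant.\<close>

definition linear_contraction_on ::
    "'a::real_normed_vector set \<Rightarrow> ('a \<Rightarrow> 'b::real_normed_vector) \<Rightarrow> bool"
  where "linear_contraction_on S U \<longleftrightarrow>
    (\<forall>x\<in>S. \<forall>y\<in>S. U (x + y) = U x + U y) \<and>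
    (\<forall>c. \<forall>x\<in>S. U (c *\<^sub>R x) = c *\<^sub>R U x) \<and>
    (\<forall>x\<in>S. norm (U x) \<le> norm x)"

definition pi2 :: "('a::banach \<Rightarrow>\<^sub>L 'b::banach) \<Rightarrow> ennreal"
  where "pi2 T =
    (SUP (n, U) \<in> {(n :: nat, U :: ell2 \<Rightarrow> 'a). n \<ge> 1 \<and> linear_contraction_on (ell2_fin n) U}.
      ennreal (sqrt (\<Sum>i<n. (norm (blinfun_apply T (U (ell2_unit i))))\<^sup>2)))"

definition two_summing_property :: "'a::banach itself \<Rightarrow> bool"
  where "two_summing_property _ \<longleftrightarrow> (\<forall>T :: 'a \<Rightarrow>\<^sub>L ell2. pi2 T = ennreal (norm T))"

definition isometrically_isomorphic ::
    "'a::real_normed_vector itself \<Rightarrow> 'b::real_normed_vector itself \<Rightarrow> bool"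
  where "isometrically_isomorphic _ _ \<longleftrightarrow>
    (\<exists>f :: 'a \<Rightarrow> 'b. linear f \<and> surj f \<and> (\<forall>x. norm (f x) = norm x))"

end

theory Submission
  imports Defs
begin

text \<open>Suppose \<open>X\<close> has the 2-summing property, and consider the John ellipse of a plane \<open>E \<subseteq> X\<close>.
  Extending the support functionals at its contact points to \<open>X\<close> and testing the property on
  operators of rank two built from them, one sees that two contact points are orthogonal and
  then that the tangents there cut out the unit ball of \<open>E\<close>.  Thus every two-dimensional
  subspace of \<open>X\<close> is isometric to \<open>\<ell>\<^sub>\<infinity>\<^sup>2\<close>.

  This is impossible in dimension three.  If all planar sections of a three-dimensional ball
  are parallelograms, then near an extreme point \<open>e\<close> the ball is a cone with at least two edges
  in some open half-space bounded by a plane through \<open>e\<close>, and a plane passing close to \<open>e\<close> that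
  meets both edges also has a vertex where it leaves the cone: its section has three pairs of
  vertices.

  Conversely, for an operator \<open>T\<close> on \<open>\<ell>\<^sub>\<infinity>\<^sup>2\<close> with values \<open>t, u\<close> on the unit vectors, both
  \<open>\<parallel>T\<parallel>\<^sup>2\<close> and the 2-summing bound are \<open>\<bar>t\<bar>\<^sup>2 + \<bar>u\<bar>\<^sup>2 + 2 \<bar>t \<bullet> u\<bar>\<close>.\<close>

section \<open>Testing the 2-summing property\<close>

lemma coord_sum: "finite A \<Longrightarrow> coord (\<Sum>i\<in>A. f i) k = (\<Sum>i\<in>A. coord (f i) k)"
  by (induction A rule: finite_induct) (simp_all add: zero_ell2.rep_eq plus_ell2.rep_eq)

lemma norm_ell2_fin:
  assumes "v \<in> ell2_fin n"
  shows "(norm v)\<^sup>2 = (\<Sum>i<n. (coord v i)\<^sup>2)"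
proof -
  have "(\<Sum>i. (coord v i)\<^sup>2) = (\<Sum>i<n. (coord v i)\<^sup>2)"
    using assms by (intro suminf_finite) (auto simp: ell2_fin_def)
  then show ?thesis by (simp add: norm_ell2_def sum_nonneg)
qed

lemma ell2_unit_in_fin: "i < n \<Longrightarrow> ell2_unit i \<in> ell2_fin n"
  by (simp add: ell2_fin_def ell2_unit.rep_eq)

lemma ell2_fin_sum_in: "(\<Sum>i<n. c i *\<^sub>R ell2_unit i) \<in> ell2_fin n"
  by (auto simp: ell2_fin_def coord_sum scaleR_ell2.rep_eq ell2_unit.rep_eq)

lemma coord_ell2_fin_sum:
  assumes "i < n"
  shows "coord (\<Sum>j<n. c j *\<^sub>R ell2_unit j) i = c i"
proof -
  have "coord (\<Sum>j<n. c j *\<^sub>R ell2_unit j) i = (\<Sum>j<n. if j = i then c j else 0)"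
    unfolding coord_sum[OF finite_lessThan]
    by (intro sum.cong) (auto simp: scaleR_ell2.rep_eq ell2_unit.rep_eq)
  then show ?thesis using assms by simp
qed

lemma norm_ell2_fin_sum: "(norm (\<Sum>i<n. c i *\<^sub>R ell2_unit i))\<^sup>2 = (\<Sum>i<n. (c i)\<^sup>2)"
  using norm_ell2_fin[OF ell2_fin_sum_in[of c n]] by (simp add: coord_ell2_fin_sum)

text \<open>The rank one map on \<open>ell2_fin 1\<close> that sends the unit vector to a normalised
  \<open>x\<close> is admissible in the supremum, so \<open>pi2 T\<close> bounds the norm of
  \<open>T\<close> at every unit vector.\<close>

lemma norm_le_pi2: "ennreal (norm T) \<le> pi2 T"
  for T :: "'a::banach \<Rightarrow>\<^sub>L 'b::banach"
proof (rule ennreal_le_epsilon)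
  fix e :: real assume e: "0 < e"
  show "ennreal (norm T) \<le> pi2 T + ennreal e"
  proof (cases "pi2 T")
    case (real r)
    have "norm (T x) \<le> r * norm x" for x
    proof (cases "x = 0")
      case False
      define y where "y = x /\<^sub>R norm x"
      have ny: "norm y = 1" using False by (simp add: y_def)
      define U where "U = (\<lambda>v. coord v 0 *\<^sub>R y)"
      have U: "linear_contraction_on (ell2_fin 1) U"
        unfolding linear_contraction_on_def U_def
        using abs_coord_le_norm[of _ 0] ny
        by (simp add: plus_ell2.rep_eq scaleR_ell2.rep_eq scaleR_add_left)
      have "ennreal (sqrt (\<Sum>i<1. (norm (T (U (ell2_unit i))))\<^sup>2)) \<le> pi2 T"
        unfolding pi2_def using U by (intro SUP_upper2[of "(1, U)"]) auto
      then have "norm (T y) \<le> r"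
        using real by (simp add: U_def ell2_unit.rep_eq ennreal_le_iff)
      then show ?thesis using False by (simp add: y_def blinfun.scaleR_right field_simps)
    qed (simp add: blinfun.zero_right)
    then have "norm T \<le> r" using real by (intro norm_blinfun_bound) auto
    then have "ennreal (norm T) \<le> ennreal (r + e)" using e by (intro ennreal_leI) auto
    then show ?thesis using real e by (simp add: ennreal_plus)
  qed simp
qed

text \<open>Every deduction from the property goes through this test. The pair
  \<open>(h\<^sub>1, h\<^sub>2)\<close> is an operator into \<open>ell2\<close> of norm at most
  \<open>sqrt C\<close>, hypothesis \<open>U\<close> makes the map sending the unit vectors to
  \<open>x\<^sub>1\<close> and \<open>x\<^sub>2\<close> a contraction, and the left side is the
  squared Hilbert-Schmidt norm of the composite.\<close>

lemma two_summing_rank_two: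
  fixes x\<^sub>1 x\<^sub>2 :: "'a::banach" and h\<^sub>1 h\<^sub>2 :: "'a \<Rightarrow> real"
  assumes two: "two_summing_property TYPE('a)"
    and h: "bounded_linear h\<^sub>1" "bounded_linear h\<^sub>2"
    and U: "\<And>a b. (norm (a *\<^sub>R x\<^sub>1 + b *\<^sub>R x\<^sub>2))\<^sup>2 \<le> a\<^sup>2 + b\<^sup>2"
    and C: "\<And>x. (h\<^sub>1 x)\<^sup>2 + (h\<^sub>2 x)\<^sup>2 \<le> C * (norm x)\<^sup>2" "0 \<le> C"
  shows "(h\<^sub>1 x\<^sub>1)\<^sup>2 + (h\<^sub>2 x\<^sub>1)\<^sup>2 + ((h\<^sub>1 x\<^sub>2)\<^sup>2 + (h\<^sub>2 x\<^sub>2)\<^sup>2) \<le> C"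
proof -
  define T where "T = (\<lambda>x. \<Sum>j<2. (if j = 0 then h\<^sub>1 x else h\<^sub>2 x) *\<^sub>R ell2_unit j)"
  have Teq: "T x = h\<^sub>1 x *\<^sub>R ell2_unit 0 + h\<^sub>2 x *\<^sub>R ell2_unit 1" for x
    by (simp add: T_def numeral_2_eq_2)
  have bl: "bounded_linear T"
    unfolding Teq by (intro bounded_linear_add bounded_linear_scaleR_const h)
  have normT: "(norm (T x))\<^sup>2 = (h\<^sub>1 x)\<^sup>2 + (h\<^sub>2 x)\<^sup>2" for x
    unfolding T_def norm_ell2_fin_sum by (simp add: numeral_2_eq_2)
  define B where "B = Blinfun T"
  have B: "blinfun_apply B = T" unfolding B_def by (rule bounded_linear_Blinfun_apply[OF bl])
  have "norm B \<le> sqrt C"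
  proof (rule norm_blinfun_bound)
    fix x
    have "norm (T x) = sqrt ((norm (T x))\<^sup>2)" by simp
    also have "\<dots> \<le> sqrt (C * (norm x)\<^sup>2)"
      unfolding normT by (intro real_sqrt_le_mono C)
    finally show "norm (B x) \<le> sqrt C * norm x" by (simp add: B real_sqrt_mult)
  qed (use C in simp)
  define V where "V = (\<lambda>v. coord v 0 *\<^sub>R x\<^sub>1 + coord v 1 *\<^sub>R x\<^sub>2)"
  have "norm (V v) \<le> norm v" if "v \<in> ell2_fin 2" for v
  proof (rule power2_le_imp_le)
    show "(norm (V v))\<^sup>2 \<le> (norm v)\<^sup>2"
      using U norm_ell2_fin[OF that] by (simp add: V_def numeral_2_eq_2)
  qed simp
  then have V: "linear_contraction_on (ell2_fin 2) V"
    by (simp add: linear_contraction_on_def V_def plus_ell2.rep_eq scaleR_ell2.rep_eq algebra_simps)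
  have "ennreal (sqrt (\<Sum>i<2. (norm (B (V (ell2_unit i))))\<^sup>2)) \<le> pi2 B"
    unfolding pi2_def using V by (intro SUP_upper2[of "(2, V)"]) auto
  also have "\<dots> = ennreal (norm B)" using two by (simp add: two_summing_property_def)
  finally have "sqrt (\<Sum>i<2. (norm (B (V (ell2_unit i))))\<^sup>2) \<le> norm B"
    by (simp add: ennreal_le_iff)
  also have "\<dots> \<le> sqrt C" by fact
  finally have "(\<Sum>i<2. (norm (B (V (ell2_unit i))))\<^sup>2) \<le> C" by simp
  then have "(norm (T x\<^sub>1))\<^sup>2 + (norm (T x\<^sub>2))\<^sup>2 \<le> C"
    by (simp add: numeral_2_eq_2 V_def ell2_unit.rep_eq B)
  then show ?thesis by (simp only: normT)
qed

text \<open>Phrased by coordinates so that one proof serves both the line, where \<open>q\<close>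
  and \<open>\<psi>\<close> vanish, and the max-norm plane. A coordinate functional composed with a
  Euclidean contraction has square sum at most one; the resulting bound for \<open>T\<close> is the
  larger of its squared norms at \<open>p + q\<close> and \<open>p - q\<close>.\<close>

lemma two_summing_if_coordinates:
  fixes p q :: "'a::banach" and \<phi> \<psi> :: "'a \<Rightarrow> real"
  assumes lin: "linear \<phi>" "linear \<psi>"
    and dec: "\<And>x. x = \<phi> x *\<^sub>R p + \<psi> x *\<^sub>R q"
    and le: "\<And>x. \<bar>\<phi> x\<bar> \<le> norm x" "\<And>x. \<bar>\<psi> x\<bar> \<le> norm x"
    and pq: "norm (p + q) \<le> 1" "norm (p - q) \<le> 1"
  shows "two_summing_property TYPE('a)"
  unfolding two_summing_property_def
proof
  fix T :: "'a \<Rightarrow>\<^sub>L ell2"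
  have bound: "sqrt (\<Sum>i<n. (norm (T (U (ell2_unit i))))\<^sup>2) \<le> norm T"
    if U: "linear_contraction_on (ell2_fin n) U" for n and U :: "ell2 \<Rightarrow> 'a"
  proof -
    have add: "U (x + y) = U x + U y" if "x \<in> ell2_fin n" "y \<in> ell2_fin n" for x y
      using U that by (simp add: linear_contraction_on_def)
    have scale: "U (c *\<^sub>R x) = c *\<^sub>R U x" if "x \<in> ell2_fin n" for c x
      using U that by (simp add: linear_contraction_on_def)
    have contr: "norm (U x) \<le> norm x" if "x \<in> ell2_fin n" for x
      using U that by (simp add: linear_contraction_on_def)
    have fin0: "0 \<in> ell2_fin n" by (simp add: ell2_fin_def zero_ell2.rep_eq)
    have fins: "(\<Sum>i\<in>A. c i *\<^sub>R ell2_unit i) \<in> ell2_fin n" if "finite A" "A \<subseteq> {..<n}" for A c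
      using that by (auto simp: ell2_fin_def coord_sum scaleR_ell2.rep_eq ell2_unit.rep_eq intro!: sum.neutral)
    have Usum: "U (\<Sum>i\<in>A. c i *\<^sub>R ell2_unit i) = (\<Sum>i\<in>A. c i *\<^sub>R U (ell2_unit i))"
      if "finite A" "A \<subseteq> {..<n}" for A c
      using that
    proof (induction A rule: finite_induct)
      case empty
      show ?case using scale[OF fin0, of 0] by simp
    next
      case (insert a A)
      have "c a *\<^sub>R ell2_unit a \<in> ell2_fin n" using fins[of "{a}" c] insert.prems by simp
      then show ?case
        using insert fins[of A c] ell2_unit_in_fin[of a n] by (simp add: add scale)
    qed
    \<comment> \<open>Euclidean duality: evaluating the functional at the vector of its own
      coefficients gives \<open>S * S \<le> S\<close>.\<close>
    have sq: "(\<Sum>i<n. (\<theta> (U (ell2_unit i)))\<^sup>2) \<le> 1"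
      if \<theta>: "linear \<theta>" "\<And>x. \<bar>\<theta> x\<bar> \<le> norm x" for \<theta> :: "'a \<Rightarrow> real"
    proof -
      define c where "c = (\<lambda>i. \<theta> (U (ell2_unit i)))"
      define S where "S = (\<Sum>i<n. (c i)\<^sup>2)"
      have S0: "0 \<le> S" by (simp add: S_def sum_nonneg)
      have "S = \<theta> (U (\<Sum>i<n. c i *\<^sub>R ell2_unit i))"
        by (simp add: Usum linear_sum[OF \<theta>(1)] linear_cmul[OF \<theta>(1)] S_def c_def power2_eq_square)
      also have "\<dots> \<le> norm (\<Sum>i<n. c i *\<^sub>R ell2_unit i)"
        using \<theta>(2) contr[OF ell2_fin_sum_in] by (meson abs_le_D1 order_trans)
      finally have "S\<^sup>2 \<le> (norm (\<Sum>i<n. c i *\<^sub>R ell2_unit i))\<^sup>2"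
        using S0 by (intro power_mono)
      then have "S * S \<le> S" unfolding norm_ell2_fin_sum by (simp add: S_def power2_eq_square)
      then have "S \<le> 1"
        using mult_strict_left_mono[of 1 S S] by (cases "1 < S") auto
      then show ?thesis by (simp add: S_def c_def)
    qed
    define a b where "a = (\<lambda>i. \<phi> (U (ell2_unit i)))" and "b = (\<lambda>i. \<psi> (U (ell2_unit i)))"
    define A where "A = (\<Sum>i<n. (a i)\<^sup>2)"
    define B where "B = (\<Sum>i<n. (b i)\<^sup>2)"
    define D where "D = (\<Sum>i<n. a i * b i)"
    have A: "A \<le> 1" using sq[OF lin(1) le(1)] by (simp add: A_def a_def)
    have B: "B \<le> 1" using sq[OF lin(2) le(2)] by (simp add: B_def b_def)
    have "0 \<le> (\<Sum>i<n. (a i - b i)\<^sup>2)" "0 \<le> (\<Sum>i<n. (a i + b i)\<^sup>2)" by (simp_all add: sum_nonneg)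
    then have "2 * D \<le> A + B" "- (2 * D) \<le> A + B"
      by (simp_all add: A_def B_def D_def power2_diff power2_sum sum.distrib sum_subtractf
          sum_distrib_left mult.assoc)
    then have D: "\<bar>D\<bar> \<le> 1" using A B by linarith
    define t u where "t = T p" and "u = T q"
    have T: "T x = \<phi> x *\<^sub>R t + \<psi> x *\<^sub>R u" for x
      unfolding t_def u_def by (subst dec[of x]) (simp add: blinfun.add_right blinfun.scaleR_right)
    have "(norm (\<alpha> *\<^sub>R t + \<beta> *\<^sub>R u))\<^sup>2 = \<alpha>\<^sup>2 * (norm t)\<^sup>2 + \<beta>\<^sup>2 * (norm u)\<^sup>2 + 2 * (t \<bullet> u) * (\<alpha> * \<beta>)" for \<alpha> \<beta>
      unfolding power2_norm_eq_inner
      by (simp add: inner_add_left inner_add_right inner_commute[of u t]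
          power2_eq_square[of \<alpha>] power2_eq_square[of \<beta>] algebra_simps)
    then have "(norm (T (U (ell2_unit i))))\<^sup>2 = (a i)\<^sup>2 * (norm t)\<^sup>2 + (b i)\<^sup>2 * (norm u)\<^sup>2 + 2 * (t \<bullet> u) * (a i * b i)" for i
      by (simp add: T a_def b_def)
    then have "(\<Sum>i<n. (norm (T (U (ell2_unit i))))\<^sup>2) = A * (norm t)\<^sup>2 + B * (norm u)\<^sup>2 + 2 * (t \<bullet> u) * D"
      by (simp add: sum.distrib A_def B_def D_def sum_distrib_left sum_distrib_right)
    also have "\<dots> \<le> 1 * (norm t)\<^sup>2 + 1 * (norm u)\<^sup>2 + 2 * \<bar>t \<bullet> u\<bar> * 1"
    proof (intro add_mono mult_right_mono A B)
      have "2 * (t \<bullet> u) * D \<le> \<bar>2 * (t \<bullet> u) * D\<bar>" by simp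
      also have "\<dots> = 2 * \<bar>t \<bullet> u\<bar> * \<bar>D\<bar>" by (simp add: abs_mult)
      also have "\<dots> \<le> 2 * \<bar>t \<bullet> u\<bar> * 1" using D by (intro mult_left_mono) auto
      finally show "2 * (t \<bullet> u) * D \<le> 2 * \<bar>t \<bullet> u\<bar> * 1" .
    qed auto
    also have "\<dots> \<le> max ((norm (t + u))\<^sup>2) ((norm (t - u))\<^sup>2)"
    proof (cases "0 \<le> t \<bullet> u")
      case True
      then show ?thesis using dot_norm[of t u] by (intro max.coboundedI1) simp
    next
      case False
      then show ?thesis using dot_norm_neg[of t u] by (intro max.coboundedI2) simp
    qed
    also have "\<dots> \<le> (norm T)\<^sup>2"
    proof -
      have "norm (t + u) \<le> norm T * norm (p + q)" "norm (t - u) \<le> norm T * norm (p - q)"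
        using norm_blinfun[of T "p + q"] norm_blinfun[of T "p - q"]
        by (simp_all add: t_def u_def blinfun.add_right blinfun.diff_right)
      moreover have "norm T * norm (p + q) \<le> norm T * 1" "norm T * norm (p - q) \<le> norm T * 1"
        using pq by (intro mult_left_mono; simp)+
      ultimately show ?thesis by (simp add: power_mono)
    qed
    finally show ?thesis by (simp add: real_le_lsqrt)
  qed
  have "pi2 T \<le> ennreal (norm T)"
    unfolding pi2_def by (rule SUP_least) (auto intro!: ennreal_leI bound)
  then show "pi2 T = ennreal (norm T)" using norm_le_pi2 by (rule antisym)
qed

section \<open>Support functionals\<close>

lemma max_abs_add_diff: "max \<bar>A + B\<bar> \<bar>A - B\<bar> = \<bar>A\<bar> + \<bar>B :: real\<bar>"
  by (simp add: max_def abs_if)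

section \<open>The Hahn-Banach theorem by minimal sublinear functions\<close>

definition sublinear :: "('a::real_vector \<Rightarrow> real) \<Rightarrow> bool"
  where "sublinear p \<longleftrightarrow> (\<forall>x y. p (x + y) \<le> p x + p y) \<and> (\<forall>c\<ge>0. \<forall>x. p (c *\<^sub>R x) = c * p x)"

lemma sublinear_add: "sublinear p \<Longrightarrow> p (x + y) \<le> p x + p y"
  and sublinear_scale: "sublinear p \<Longrightarrow> 0 \<le> c \<Longrightarrow> p (c *\<^sub>R x) = c * p x"
  by (simp_all add: sublinear_def)

lemma sublinear_zero: "sublinear p \<Longrightarrow> p 0 = 0"
  using sublinear_scale[of p 0 0] by simp

lemma sublinear_minus: "sublinear p \<Longrightarrow> - p (- x) \<le> p x"
  using sublinear_add[of p x "- x"] sublinear_zero[of p] by simp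

lemma sublinearI:
  assumes "\<And>x y. p (x + y) \<le> p x + p y" "p 0 = 0"
    and le: "\<And>c x. 0 < c \<Longrightarrow> p (c *\<^sub>R x) \<le> c * p x"
  shows "sublinear p"
  unfolding sublinear_def
proof (intro conjI allI impI)
  fix c :: real and x assume "0 \<le> c"
  show "p (c *\<^sub>R x) = c * p x"
  proof (cases "c = 0")
    case False
    then have c: "0 < c" using \<open>0 \<le> c\<close> by simp
    have "p (inverse c *\<^sub>R (c *\<^sub>R x)) \<le> inverse c * p (c *\<^sub>R x)" using c by (intro le) simp
    then have "c * p x \<le> p (c *\<^sub>R x)" using c by (simp add: field_simps)
    then show ?thesis using le[OF c, of x] by simp
  qed (simp add: assms)
qed (use assms in auto)

text \<open>Subadditivity comes from the chain condition: of two members \<open>p\<close> and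
  \<open>q\<close> the smaller one, \<open>r\<close>, satisfies
  \<open>r (x + y) \<le> p x + q y\<close>.\<close>

lemma sublinear_INF_chain:
  assumes "C \<noteq> {}"
    and sub: "\<And>p. p \<in> C \<Longrightarrow> sublinear p"
    and chain: "\<And>p q. p \<in> C \<Longrightarrow> q \<in> C \<Longrightarrow> p \<le> q \<or> q \<le> p"
    and bdd: "\<And>x. bdd_below ((\<lambda>p. p x) ` C)"
  shows "sublinear (\<lambda>x. INF p\<in>C. p x)"
proof (rule sublinearI)
  fix x y
  have "(INF p\<in>C. p (x + y)) \<le> p x + q y" if "p \<in> C" "q \<in> C" for p q
  proof -
    have "\<exists>r\<in>C. r \<le> p \<and> r \<le> q" using chain[OF that] that by (elim disjE) (auto intro: bexI)
    then obtain r where r: "r \<in> C" "r \<le> p" "r \<le> q" by (elim bexE conjE)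
    have "(INF p\<in>C. p (x + y)) \<le> r (x + y)" using r(1) by (intro cINF_lower bdd)
    also have "\<dots> \<le> r x + r y" by (intro sublinear_add sub r)
    finally show ?thesis using le_funD[OF r(2), of x] le_funD[OF r(3), of y] by linarith
  qed
  then have "(INF p\<in>C. p (x + y)) - q y \<le> (INF p\<in>C. p x)" if "q \<in> C" for q
    using assms(1) that by (intro cINF_greatest) (auto simp: algebra_simps)
  then have "(INF p\<in>C. p (x + y)) - (INF p\<in>C. p x) \<le> (INF p\<in>C. p y)"
    using assms(1) by (intro cINF_greatest) (auto simp: algebra_simps)
  then show "(INF p\<in>C. p (x + y)) \<le> (INF p\<in>C. p x) + (INF p\<in>C. p y)" by simp
next
  have "(INF p\<in>C. p 0) = (INF p\<in>C. 0)" using sublinear_zero[OF sub] by (intro INF_cong) auto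
  then show "(INF p\<in>C. p 0) = 0" using assms(1) by simp
next
  fix c :: real and x assume c: "0 < c"
  have "(INF p\<in>C. p (c *\<^sub>R x)) / c \<le> (INF p\<in>C. p x)"
  proof (rule cINF_greatest[OF assms(1)])
    fix p assume p: "p \<in> C"
    have "(INF p\<in>C. p (c *\<^sub>R x)) \<le> p (c *\<^sub>R x)" using p by (intro cINF_lower bdd)
    then show "(INF p\<in>C. p (c *\<^sub>R x)) / c \<le> p x"
      using c sublinear_scale[OF sub[OF p], of c x] by (simp add: field_simps)
  qed
  then show "(INF p\<in>C. p (c *\<^sub>R x)) \<le> c * (INF p\<in>C. p x)" using c by (simp add: field_simps)
qed

text \<open>Taking \<open>q y = inf\<^sub>t (p (y + t x) - t p x)\<close> over \<open>t \<ge> 0\<close> shows that a minimal sublinear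
  \<open>p\<close> is additive; at \<open>y = - x\<close> the bound makes \<open>q\<close> support \<open>p\<close> at \<open>x\<close>.\<close>

lemma sublinear_shift:
  assumes p: "sublinear p"
  obtains q where "sublinear q" "q \<le> p" "\<And>y. q y \<le> p (y + x) - p x"
proof -
  define q where "q = (\<lambda>y. INF t\<in>{0..}. p (y + t *\<^sub>R x) - t * p x)"
  have lb: "- p (- y) \<le> p (y + t *\<^sub>R x) - t * p x" if "0 \<le> t" for t y
    using sublinear_add[OF p, of "y + t *\<^sub>R x" "- y"] sublinear_scale[OF p that, of x] by simp
  then have bdd: "bdd_below ((\<lambda>t. p (y + t *\<^sub>R x) - t * p x) ` {0..})" for y
    by (intro bdd_belowI2[where m = "- p (- y)"]) simp
  have le: "q y \<le> p (y + t *\<^sub>R x) - t * p x" if "0 \<le> t" for t y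
    unfolding q_def using that by (intro cINF_lower bdd) simp
  have ge: "m \<le> q y" if "\<And>t. 0 \<le> t \<Longrightarrow> m \<le> p (y + t *\<^sub>R x) - t * p x" for m y
    unfolding q_def using that by (intro cINF_greatest) auto
  have "sublinear q"
  proof (rule sublinearI)
    fix y z
    have "q (y + z) \<le> (p (y + s *\<^sub>R x) - s * p x) + (p (z + t *\<^sub>R x) - t * p x)"
      if "0 \<le> s" "0 \<le> t" for s t
      using le[of "s + t" "y + z"] sublinear_add[OF p, of "y + s *\<^sub>R x" "z + t *\<^sub>R x"] that
      by (simp add: algebra_simps)
    then have "q (y + z) - (p (z + t *\<^sub>R x) - t * p x) \<le> q y" if "0 \<le> t" for t
      using that by (intro ge) (simp add: algebra_simps)
    then have "q (y + z) - q y \<le> q z" by (intro ge) (simp add: algebra_simps)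
    then show "q (y + z) \<le> q y + q z" by simp
  next
    show "q 0 = 0"
      using le[of 0 0] ge[of 0 0] sublinear_zero[OF p] sublinear_scale[OF p, of _ x] by force
  next
    fix c :: real and y assume c: "0 < c"
    have "q (c *\<^sub>R y) / c \<le> q y"
    proof (rule ge)
      fix t :: real assume t: "0 \<le> t"
      have "q (c *\<^sub>R y) \<le> p (c *\<^sub>R (y + t *\<^sub>R x)) - c * t * p x"
        using le[of "c * t" "c *\<^sub>R y"] c t by (simp add: scaleR_add_right)
      also have "\<dots> = c * (p (y + t *\<^sub>R x) - t * p x)"
        using c sublinear_scale[OF p, of c "y + t *\<^sub>R x"] by (simp add: right_diff_distrib)
      finally show "q (c *\<^sub>R y) / c \<le> p (y + t *\<^sub>R x) - t * p x" using c by (simp add: field_simps)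
    qed
    then show "q (c *\<^sub>R y) \<le> c * q y" using c by (simp add: field_simps)
  qed
  moreover have "q \<le> p" using le[of 0] by (simp add: le_fun_def)
  moreover have "q y \<le> p (y + x) - p x" for y using le[of 1 y] by simp
  ultimately show thesis by (rule that)
qed

text \<open>Hahn-Banach by Zorn's lemma. The order is reversed, so a maximal element is a minimal
  sublinear function below \<open>p\<^sub>0\<close>. As \<open>sublinear_shift\<close> cannot lower
  it, it is superadditive and therefore linear.\<close>

theorem sublinear_dominates_linear:
  fixes p\<^sub>0 :: "'a::real_vector \<Rightarrow> real"
  assumes p0: "sublinear p\<^sub>0"
  obtains h where "linear h" "\<And>x. h x \<le> p\<^sub>0 x"
proof -
  define A where "A = {p. sublinear p \<and> p \<le> p\<^sub>0}"
  have "\<exists>m\<in>A. \<forall>a\<in>A. m \<ge> a \<longrightarrow> a = m"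
  proof (rule predicate_Zorn)
    show "partial_order_on A (relation_of (\<ge>) A)"
      by (rule partial_order_on_relation_ofI) auto
    fix C assume "C \<in> Chains (relation_of (\<ge>) A)"
    then have C: "C \<subseteq> A" and chain: "\<And>p q. p \<in> C \<Longrightarrow> q \<in> C \<Longrightarrow> p \<le> q \<or> q \<le> p"
      by (auto simp: Chains_def relation_of_def)
    show "\<exists>u\<in>A. \<forall>a\<in>C. a \<ge> u"
    proof (cases "C = {}")
      case True
      then show ?thesis using p0 by (auto simp: A_def)
    next
      case False
      \<comment> \<open>The infimum over the chain is finite because every
        \<open>p \<le> p\<^sub>0\<close> satisfies \<open>- p\<^sub>0 (- x) \<le> - p (- x)\<close>
        and \<open>- p (- x) \<le> p x\<close>.\<close>
      have bdd: "bdd_below ((\<lambda>p. p x) ` C)" for x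
      proof (rule bdd_belowI2)
        fix p assume "p \<in> C"
        then have "sublinear p" "p (- x) \<le> p\<^sub>0 (- x)" using C by (auto simp: A_def le_fun_def)
        then show "- p\<^sub>0 (- x) \<le> p x" using sublinear_minus[of p x] by linarith
      qed
      define u where "u = (\<lambda>x. INF p\<in>C. p x)"
      have low: "u \<le> p" if "p \<in> C" for p
        unfolding u_def le_fun_def using that by (auto intro: cINF_lower bdd)
      have "sublinear u"
        unfolding u_def using C False chain bdd by (intro sublinear_INF_chain) (auto simp: A_def)
      moreover have "u \<le> p\<^sub>0" using False low C by (force simp: A_def intro: order_trans)
      ultimately show ?thesis using low by (auto simp: A_def)
    qed
  qed
  then obtain h where h: "sublinear h" "h \<le> p\<^sub>0" and min: "\<And>q. sublinear q \<Longrightarrow> q \<le> h \<Longrightarrow> q = h"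
    unfolding A_def by (metis (mono_tags, lifting) mem_Collect_eq order_trans)
  have super: "h x + h y \<le> h (x + y)" for x y
  proof -
    obtain q where "sublinear q" "q \<le> h" "\<And>y. q y \<le> h (y + x) - h x"
      using sublinear_shift[OF h(1), of x] by blast
    with min[of q] show ?thesis by (metis add.commute le_diff_eq)
  qed
  have add: "h (x + y) = h x + h y" for x y
    using super[of x y] sublinear_add[OF h(1), of x y] by simp
  have neg: "h (- x) = - h x" for x
    using add[of x "- x"] sublinear_zero[OF h(1)] by simp
  have "h (c *\<^sub>R x) = c * h x" for c x
  proof (cases "0 \<le> c")
    case False
    then show ?thesis using sublinear_scale[OF h(1), of "- c" x] neg[of "c *\<^sub>R x"] by simp
  qed (simp add: sublinear_scale[OF h(1)])
  then have "linear h" by (intro linearI) (simp_all add: add)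
  then show thesis using h(2) by (intro that) (auto simp: le_fun_def)
qed

text \<open>The norm is shifted at \<open>x\<close> before a linear minorant is taken; then every
  linear \<open>h\<close> below \<open>q\<close> has \<open>h (- x) \<le> - norm x\<close>, so no
  extension from a subspace is involved.\<close>

corollary support_functional:
  fixes x :: "'a::real_normed_vector"
  obtains h where "linear h" "\<And>y. \<bar>h y\<bar> \<le> norm y" "h x = norm x"
proof -
  have "sublinear (norm :: 'a \<Rightarrow> real)"
    by (auto simp: sublinear_def norm_triangle_ineq)
  then obtain q where q: "sublinear q" "q \<le> norm" "\<And>y. q y \<le> norm (y + x) - norm x"
    using sublinear_shift by blast
  obtain h where h: "linear h" "\<And>y. h y \<le> q y"
    using sublinear_dominates_linear[OF q(1)] by blast
  have le: "h y \<le> norm y" for y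
    using h(2)[of y] q(2) by (meson le_fun_def order_trans)
  have "\<bar>h y\<bar> \<le> norm y" for y
    using le[of y] le[of "- y"] linear_neg[OF h(1), of y] by simp
  moreover have "h x = norm x"
    using le[of x] h(2)[of "- x"] q(3)[of "- x"] linear_neg[OF h(1), of x] by simp
  ultimately show thesis using h(1) that by blast
qed

lemma bounded_linear_functional:
  fixes h :: "'a::real_normed_vector \<Rightarrow> real"
  assumes "linear h" "\<And>y. \<bar>h y\<bar> \<le> norm y"
  shows "bounded_linear h"
  using assms by (intro bounded_linear_intro[of h 1]) (auto simp: linear_add linear_cmul)

section \<open>The John ellipse of a plane\<close>

text \<open>The functionals confine the section to a square; this puts a corner of that square into
  the ball. The untilted operator built from \<open>g\<^sub>1\<close> and \<open>g\<^sub>2\<close>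
  attains equality in \<open>two_summing_rank_two\<close>, so any first-order gain breaks the
  bound.\<close>

lemma two_summing_corner:
  fixes x\<^sub>1 x\<^sub>2 :: "'a::banach"
  assumes two: "two_summing_property TYPE('a)"
    and U: "\<And>a b. (norm (a *\<^sub>R x\<^sub>1 + b *\<^sub>R x\<^sub>2))\<^sup>2 \<le> a\<^sup>2 + b\<^sup>2"
    and g: "linear g\<^sub>1" "\<And>x. \<bar>g\<^sub>1 x\<bar> \<le> norm x" "linear g\<^sub>2" "\<And>x. \<bar>g\<^sub>2 x\<bar> \<le> norm x"
    and dual: "g\<^sub>1 x\<^sub>1 = 1" "g\<^sub>1 x\<^sub>2 = 0" "g\<^sub>2 x\<^sub>1 = 0" "g\<^sub>2 x\<^sub>2 = 1"
  shows "norm (x\<^sub>1 + x\<^sub>2) \<le> 1"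
proof (rule ccontr)
  assume "\<not> ?thesis"
  then obtain \<delta> where \<delta>: "norm (x\<^sub>1 + x\<^sub>2) = 1 + \<delta>" "0 < \<delta>"
    by (metis add.commute diff_add_cancel diff_gt_0_iff_gt not_le)
  obtain h where h: "linear h" "\<And>y. \<bar>h y\<bar> \<le> norm y" "h (x\<^sub>1 + x\<^sub>2) = norm (x\<^sub>1 + x\<^sub>2)"
    using support_functional[of "x\<^sub>1 + x\<^sub>2"] by blast
  \<comment> \<open>\<open>\<epsilon> < \<delta>\<close> contradicts the final
    \<open>\<epsilon> * \<delta> \<le> \<epsilon>\<^sup>2\<close>, and \<open>\<epsilon> < 1\<close>
    keeps the weights in \<open>k\<close> nonnegative.\<close>
  define \<epsilon> where "\<epsilon> = min \<delta> 1 / 2"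
  have \<epsilon>: "0 < \<epsilon>" "\<epsilon> < 1" "\<epsilon> < \<delta>" using \<delta> by (auto simp: \<epsilon>_def min_def)
  \<comment> \<open>\<open>(s, d)\<close> is \<open>(g\<^sub>1, g\<^sub>2) / \<surd>2\<close> in rotated coordinates.  Tilting \<open>s\<close> towards \<open>h\<close> gains a
    multiple of \<open>\<epsilon>\<close> on \<open>x\<^sub>1, x\<^sub>2\<close> and costs only \<open>\<epsilon>\<^sup>2\<close> in norm.\<close>
  define s d where "s = (\<lambda>x. (g\<^sub>1 x + g\<^sub>2 x) / 2)" and "d = (\<lambda>x. (g\<^sub>1 x - g\<^sub>2 x) / 2)"
  define k where "k = (\<lambda>x. (1 - \<epsilon>) * s x + \<epsilon> * h x)"
  note bl = bounded_linear_functional[OF g(1,2)] bounded_linear_functional[OF g(3,4)]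
    bounded_linear_functional[OF h(1,2)]
  have "(k x)\<^sup>2 + (d x)\<^sup>2 \<le> (1 + \<epsilon>\<^sup>2) * (norm x)\<^sup>2" for x
  proof -
    define \<sigma> n where "\<sigma> = \<bar>s x\<bar>" and "n = norm x"
    have sd: "\<sigma> + \<bar>d x\<bar> \<le> n" "0 \<le> \<sigma>"
      using g(2)[of x] g(4)[of x] max_abs_add_diff[of "s x" "d x"]
      by (auto simp: \<sigma>_def n_def s_def d_def field_simps)
    have "\<bar>k x\<bar> \<le> \<bar>(1 - \<epsilon>) * s x\<bar> + \<bar>\<epsilon> * h x\<bar>" unfolding k_def by (rule abs_triangle_ineq)
    also have "\<dots> \<le> (1 - \<epsilon>) * \<sigma> + \<epsilon> * n"
      using h(2)[of x] \<epsilon> by (simp add: abs_mult \<sigma>_def n_def)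
    finally have "\<bar>k x\<bar>\<^sup>2 \<le> ((1 - \<epsilon>) * \<sigma> + \<epsilon> * n)\<^sup>2" by (intro power_mono) auto
    moreover have "\<bar>d x\<bar>\<^sup>2 \<le> (n - \<sigma>)\<^sup>2" using sd by (intro power_mono) auto
    \<comment> \<open>The slack is written with factors that are nonnegative because
      \<open>0 \<le> \<sigma>\<close> and \<open>\<sigma> \<le> n\<close>.\<close>
    moreover have "(1 + \<epsilon>\<^sup>2) * n\<^sup>2 - (((1 - \<epsilon>) * \<sigma> + \<epsilon> * n)\<^sup>2 + (n - \<sigma>)\<^sup>2)
        = \<sigma> * ((1 + (1 - \<epsilon>)\<^sup>2) * (n - \<sigma>)) + \<epsilon>\<^sup>2 * (\<sigma> * n)"
      by (simp add: power2_eq_square algebra_simps)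
    moreover have "0 \<le> \<sigma> * ((1 + (1 - \<epsilon>)\<^sup>2) * (n - \<sigma>)) + \<epsilon>\<^sup>2 * (\<sigma> * n)"
      using sd by (intro add_nonneg_nonneg mult_nonneg_nonneg) auto
    ultimately show ?thesis by (simp add: n_def)
  qed
  moreover have "bounded_linear k" "bounded_linear d"
    unfolding k_def d_def s_def
    by (intro bounded_linear_add bounded_linear_sub bounded_linear_const_mult bl
        bounded_linear_divide[THEN bounded_linear_compose])+
  ultimately have le: "(k x\<^sub>1)\<^sup>2 + (d x\<^sub>1)\<^sup>2 + ((k x\<^sub>2)\<^sup>2 + (d x\<^sub>2)\<^sup>2) \<le> 1 + \<epsilon>\<^sup>2"
    by (intro two_summing_rank_two[OF two _ _ U]) auto
  have h_sum: "h x\<^sub>1 + h x\<^sub>2 = 1 + \<delta>" using h(3) \<delta> linear_add[OF h(1)] by simp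
  have "k x\<^sub>1 + k x\<^sub>2 = 1 - \<epsilon> + \<epsilon> * (h x\<^sub>1 + h x\<^sub>2)"
    by (simp add: k_def s_def dual algebra_simps)
  also have "\<dots> = 1 + \<epsilon> * \<delta>" unfolding h_sum by (simp add: algebra_simps)
  finally have k_sum: "k x\<^sub>1 + k x\<^sub>2 = 1 + \<epsilon> * \<delta>" .
  have "(1 + \<epsilon> * \<delta>)\<^sup>2 \<le> 2 * ((k x\<^sub>1)\<^sup>2 + (k x\<^sub>2)\<^sup>2)"
    using zero_le_power2[of "k x\<^sub>1 - k x\<^sub>2"] power2_sum[of "k x\<^sub>1" "k x\<^sub>2"]
    unfolding k_sum by (simp add: power2_diff)
  moreover have "2 * ((d x\<^sub>1)\<^sup>2 + (d x\<^sub>2)\<^sup>2) = 1" by (simp add: d_def dual power2_eq_square)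
  moreover have "(1 + \<epsilon> * \<delta>)\<^sup>2 = 1 + 2 * (\<epsilon> * \<delta>) + (\<epsilon> * \<delta>)\<^sup>2" by (simp add: power2_sum)
  ultimately have "\<epsilon> * \<delta> \<le> \<epsilon>\<^sup>2" using le zero_le_power2[of "\<epsilon> * \<delta>"] by argo
  then show False using \<epsilon> by (simp add: power2_eq_square)
qed

text \<open>In terms of \<open>p + q\<close> and \<open>p - q\<close> the coefficients are
  \<open>(a + b) / 2\<close> and \<open>(a - b) / 2\<close>, whose absolute values add up to the
  maximum.\<close>

lemma max_combination_le:
  fixes p q :: "'a::real_normed_vector"
  assumes "norm (p + q) \<le> 1" "norm (p - q) \<le> 1"
  shows "norm (a *\<^sub>R p + b *\<^sub>R q) \<le> max \<bar>a\<bar> \<bar>b\<bar>"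
proof -
  have "a *\<^sub>R p + b *\<^sub>R q = ((a + b) / 2) *\<^sub>R (p + q) + ((a - b) / 2) *\<^sub>R (p - q)"
    by (simp add: scaleR_add_right scaleR_diff_right add_divide_distrib diff_divide_distrib
        scaleR_add_left scaleR_diff_left) (simp add: algebra_simps flip: scaleR_add_left)
  also have "norm \<dots> \<le> \<bar>(a + b) / 2\<bar> * norm (p + q) + \<bar>(a - b) / 2\<bar> * norm (p - q)"
    by (rule norm_triangle_le) simp
  also have "\<dots> \<le> \<bar>(a + b) / 2\<bar> * 1 + \<bar>(a - b) / 2\<bar> * 1"
    by (intro add_mono mult_left_mono assms) auto
  also have "\<dots> = max \<bar>a\<bar> \<bar>b\<bar>" by (simp add: max_def abs_if field_simps)
  finally show ?thesis .
qed

text \<open>The upper bound is convexity once two adjacent corners lie in the ball; the second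
  corner comes from replacing \<open>x\<^sub>2\<close> and \<open>g\<^sub>2\<close> by their
  negatives. The functionals give the lower bound.\<close>

lemma two_summing_square:
  fixes x\<^sub>1 x\<^sub>2 :: "'a::banach"
  assumes two: "two_summing_property TYPE('a)"
    and U: "\<And>a b. (norm (a *\<^sub>R x\<^sub>1 + b *\<^sub>R x\<^sub>2))\<^sup>2 \<le> a\<^sup>2 + b\<^sup>2"
    and g: "linear g\<^sub>1" "\<And>x. \<bar>g\<^sub>1 x\<bar> \<le> norm x" "linear g\<^sub>2" "\<And>x. \<bar>g\<^sub>2 x\<bar> \<le> norm x"
    and dual: "g\<^sub>1 x\<^sub>1 = 1" "g\<^sub>1 x\<^sub>2 = 0" "g\<^sub>2 x\<^sub>1 = 0" "g\<^sub>2 x\<^sub>2 = 1"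
  shows "norm (a *\<^sub>R x\<^sub>1 + b *\<^sub>R x\<^sub>2) = max \<bar>a\<bar> \<bar>b\<bar>"
proof (rule antisym)
  have "norm (x\<^sub>1 + x\<^sub>2) \<le> 1" by (rule two_summing_corner[OF two U g dual])
  moreover have "norm (x\<^sub>1 + - x\<^sub>2) \<le> 1"
  proof (rule two_summing_corner[OF two _ g(1,2), of _ _ "\<lambda>x. - g\<^sub>2 x"])
    show "(norm (a *\<^sub>R x\<^sub>1 + b *\<^sub>R - x\<^sub>2))\<^sup>2 \<le> a\<^sup>2 + b\<^sup>2" for a b
      using U[of a "- b"] by simp
    show "linear (\<lambda>x. - g\<^sub>2 x)" using g(3) by (rule linear_compose_neg)
  qed (use g dual in \<open>simp_all add: linear_neg\<close>)
  ultimately show "norm (a *\<^sub>R x\<^sub>1 + b *\<^sub>R x\<^sub>2) \<le> max \<bar>a\<bar> \<bar>b\<bar>"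
    by (intro max_combination_le) simp_all
  show "max \<bar>a\<bar> \<bar>b\<bar> \<le> norm (a *\<^sub>R x\<^sub>1 + b *\<^sub>R x\<^sub>2)"
    using g(2,4)[of "a *\<^sub>R x\<^sub>1 + b *\<^sub>R x\<^sub>2"]
    by (simp add: linear_add linear_cmul g(1,3) dual)
qed

section \<open>Compactness and the ellipse of maximal area\<close>

text \<open>Serves twice: it bounds the set of inscribed ellipses, and in dimension three it yields,
  after rescaling, the point of the unit sphere farthest from the origin in the Euclidean
  norm.\<close>

lemma linear_injective_attains_min:
  fixes W :: "'e::euclidean_space \<Rightarrow> 'a::real_normed_vector"
  assumes W: "linear W" and inj: "\<And>z. W z = 0 \<Longrightarrow> z = 0"
  obtains e where "norm e = 1" "0 < norm (W e)" "\<And>z. norm (W e) * norm z \<le> norm (W z)"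
proof -
  have "continuous_on (sphere 0 1) (\<lambda>z. norm (W z))"
    using W by (intro continuous_on_norm linear_continuous_on) (simp add: linear_conv_bounded_linear)
  moreover have "sphere (0 :: 'e) 1 \<noteq> {}" by simp
  ultimately obtain z\<^sub>0 where z0: "z\<^sub>0 \<in> sphere 0 1" "\<And>z. z \<in> sphere 0 1 \<Longrightarrow> norm (W z\<^sub>0) \<le> norm (W z)"
    using continuous_attains_inf[OF compact_sphere] by metis
  show thesis
  proof
    show "norm z\<^sub>0 = 1" using z0(1) by simp
    show "0 < norm (W z\<^sub>0)" using inj[of z\<^sub>0] z0(1) by auto
    fix z
    show "norm (W z\<^sub>0) * norm z \<le> norm (W z)"
    proof (cases "z = 0")
      case False
      have "norm (W z\<^sub>0) \<le> norm (W (inverse (norm z) *\<^sub>R z))" using False by (intro z0) simp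
      also have "\<dots> = norm (W z) / norm z" by (simp add: linear_cmul[OF W] divide_inverse mult.commute)
      finally show ?thesis using False by (simp add: field_simps)
    qed simp
  qed
qed

text \<open>Real-linear maps of the complex plane are written \<open>w \<mapsto> \<alpha> w + \<beta> cnj w\<close>; the determinant is
  then \<open>|\<alpha>|\<^sup>2 - |\<beta>|\<^sup>2\<close>.\<close>

lemma maximal_ellipse:
  fixes W :: "complex \<Rightarrow> 'a::real_normed_vector"
  assumes W: "linear W" and inj: "\<And>z. W z = 0 \<Longrightarrow> z = 0"
  obtains \<alpha> \<beta> where "\<And>w. norm (W (\<alpha> * w + \<beta> * cnj w)) \<le> norm w"
    and "0 < (norm \<alpha>)\<^sup>2 - (norm \<beta>)\<^sup>2"
    and "\<And>\<alpha>' \<beta>' t. 0 < t \<Longrightarrow> (\<And>w. norm (W (\<alpha>' * w + \<beta>' * cnj w)) \<le> t * norm w) \<Longrightarrow>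
      (norm \<alpha>')\<^sup>2 - (norm \<beta>')\<^sup>2 \<le> t\<^sup>2 * ((norm \<alpha>)\<^sup>2 - (norm \<beta>)\<^sup>2)"
proof -
  obtain m where m: "0 < m" "\<And>z. m * norm z \<le> norm (W z)"
    using linear_injective_attains_min[OF W inj] by blast
  have blW: "bounded_linear W" using W by (simp add: linear_conv_bounded_linear)
  have cont: "continuous_on UNIV W" by (rule linear_continuous_on[OF blW])
  define K where "K = {p. \<forall>w. norm (W (fst p * w + snd p * cnj w)) \<le> norm w}"
  have "closed K"
    unfolding K_def
    by (intro closed_Collect_all closed_Collect_le continuous_intros continuous_on_compose2[OF cont]) auto
  moreover have "bounded K"
  proof (rule boundedI)
    fix p assume "p \<in> K"
    then have p: "m * norm (fst p * w + snd p * cnj w) \<le> norm w" for w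
      using m(2) order_trans unfolding K_def by blast
    \<comment> \<open>Testing at \<open>1\<close> and \<open>\<i>\<close> bounds the sum and the
      difference of the two coefficients.\<close>
    have "norm (\<i> * (fst p - snd p)) = norm (fst p - snd p)" by (simp add: norm_mult)
    then have "norm (fst p + snd p) \<le> 1 / m" "norm (fst p - snd p) \<le> 1 / m"
      using p[of 1] p[of \<i>] m(1) by (simp_all add: field_simps)
    moreover have "norm (2 * fst p) \<le> norm (fst p + snd p) + norm (fst p - snd p)"
      using norm_triangle_ineq[of "fst p + snd p" "fst p - snd p"] by simp
    moreover have "norm (2 * snd p) \<le> norm (fst p + snd p) + norm (fst p - snd p)"
      using norm_triangle_ineq4[of "fst p + snd p" "fst p - snd p"] by simp
    ultimately have "norm (fst p) + norm (snd p) \<le> 2 / m" by (simp add: norm_mult)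
    then show "norm p \<le> 2 / m"
      using norm_Pair_le[of "fst p" "snd p"] by simp
  qed
  ultimately have "compact K" by (simp add: compact_eq_bounded_closed)
  moreover have "(0, 0) \<in> K" by (simp add: K_def linear_0[OF W])
  moreover have "continuous_on K (\<lambda>p. (norm (fst p))\<^sup>2 - (norm (snd p))\<^sup>2)" by (intro continuous_intros)
  ultimately obtain p where p: "p \<in> K"
    "\<And>q. q \<in> K \<Longrightarrow> (norm (fst q))\<^sup>2 - (norm (snd q))\<^sup>2 \<le> (norm (fst p))\<^sup>2 - (norm (snd p))\<^sup>2"
    using continuous_attains_sup[of K "\<lambda>p. (norm (fst p))\<^sup>2 - (norm (snd p))\<^sup>2"] by blast
  show thesis
  proof (rule that[of "fst p" "snd p"])
    show "norm (W (fst p * w + snd p * cnj w)) \<le> norm w" for w using p(1) by (simp add: K_def)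
    \<comment> \<open>A small disc is an admissible ellipse, so the maximal determinant is
      positive.\<close>
    obtain B where B: "0 < B" "\<And>x. norm (W x) \<le> norm x * B"
      using bounded_linear.pos_bounded[OF blW] by blast
    have "norm (W (complex_of_real (1 / B) * w)) \<le> norm w" for w
      using B(2)[of "complex_of_real (1 / B) * w"] B(1) by (simp add: norm_mult norm_divide)
    then have "(complex_of_real (1 / B), 0) \<in> K" unfolding K_def by simp
    from p(2)[OF this] have "(1 / B)\<^sup>2 \<le> (norm (fst p))\<^sup>2 - (norm (snd p))\<^sup>2"
      using B(1) by (simp add: norm_divide)
    moreover have "0 < (1 / B)\<^sup>2" using B(1) by simp
    ultimately show "0 < (norm (fst p))\<^sup>2 - (norm (snd p))\<^sup>2" by linarith
  next
    fix \<alpha> \<beta> :: complex and t :: real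
    assume t: "0 < t" and le: "\<And>w. norm (W (\<alpha> * w + \<beta> * cnj w)) \<le> t * norm w"
    have "norm (W ((\<alpha> / t) * w + (\<beta> / t) * cnj w)) \<le> norm w" for w
    proof -
      have "(\<alpha> / t) * w + (\<beta> / t) * cnj w = inverse t *\<^sub>R (\<alpha> * w + \<beta> * cnj w)"
        using t by (simp add: scaleR_conv_of_real field_simps)
      then have "norm (W ((\<alpha> / t) * w + (\<beta> / t) * cnj w)) = inverse t * norm (W (\<alpha> * w + \<beta> * cnj w))"
        using t by (simp add: linear_cmul[OF W])
      also have "\<dots> \<le> inverse t * (t * norm w)" using t le by (intro mult_left_mono) auto
      also have "\<dots> = norm w" using t by (simp add: field_simps)
      finally show ?thesis .
    qed
    then have "(\<alpha> / t, \<beta> / t) \<in> K" unfolding K_def by simp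
    from p(2)[OF this] show "(norm \<alpha>)\<^sup>2 - (norm \<beta>)\<^sup>2 \<le> t\<^sup>2 * ((norm (fst p))\<^sup>2 - (norm (snd p))\<^sup>2)"
      using t by (simp add: norm_divide power_divide field_simps)
  qed
qed

section \<open>Contact points and John's condition\<close>

definition contacts :: "(complex \<Rightarrow> 'a::real_normed_vector) \<Rightarrow> complex set"
  where "contacts U = {u. norm u = 1 \<and> norm (U u) = 1}"

text \<open>John's condition \<open>\<Sum> c\<^sub>j u\<^sub>j \<otimes> u\<^sub>j = I\<close> for the contact points of the maximal ellipse
  becomes, after squaring the complex numbers \<open>u\<^sub>j\<close>, the condition \<open>\<Sum> c\<^sub>j u\<^sub>j\<^sup>2 = 0\<close>.  If it fails,
  a separating functional gives a direction in which to squeeze and stretch the ellipse.\<close>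

lemma john_contacts:
  fixes W :: "complex \<Rightarrow> 'a::real_normed_vector"
  assumes W: "linear W"
    and le: "\<And>w. norm (W (\<alpha> * w + \<beta> * cnj w)) \<le> norm w"
    and pos: "0 < (norm \<alpha>)\<^sup>2 - (norm \<beta>)\<^sup>2"
    and max: "\<And>\<alpha>' \<beta>' t. 0 < t \<Longrightarrow> (\<And>w. norm (W (\<alpha>' * w + \<beta>' * cnj w)) \<le> t * norm w) \<Longrightarrow>
      (norm \<alpha>')\<^sup>2 - (norm \<beta>')\<^sup>2 \<le> t\<^sup>2 * ((norm \<alpha>)\<^sup>2 - (norm \<beta>)\<^sup>2)"
  shows "0 \<in> convex hull ((\<lambda>u. u\<^sup>2) ` contacts (\<lambda>w. W (\<alpha> * w + \<beta> * cnj w)))"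
proof (rule ccontr)
  define U where "U = (\<lambda>w. W (\<alpha> * w + \<beta> * cnj w))"
  define S where "S = (\<lambda>u. u\<^sup>2) ` contacts U"
  assume "\<not> ?thesis"
  then have notin: "0 \<notin> convex hull S" by (simp add: S_def U_def)
  have cont: "continuous_on UNIV W" using W by (intro linear_continuous_on) (simp add: linear_conv_bounded_linear)
  have contU: "continuous_on A (\<lambda>w. norm (U w))" for A
    unfolding U_def by (intro continuous_intros continuous_on_compose2[OF cont]) auto
  have "contacts U = sphere 0 1 \<inter> {u. norm (U u) = 1}" by (auto simp: contacts_def)
  moreover have "closed {u. norm (U u) = 1}" by (intro closed_Collect_eq contU continuous_on_const)
  ultimately have "compact (contacts U)" by (simp add: compact_Int_closed)
  then have "compact S" unfolding S_def by (intro compact_continuous_image continuous_intros)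
  then have "closed (convex hull S)" by (intro compact_imp_closed compact_convex_hull)
  then obtain c b where c: "c \<noteq> 0" and b: "0 < b" and sep: "\<And>\<sigma>. \<sigma> \<in> convex hull S \<Longrightarrow> b < c \<bullet> \<sigma>"
    using separating_hyperplane_closed_0[OF convex_convex_hull _ notin] by blast
  have far: "b < c \<bullet> u\<^sup>2" if "norm u = 1" "norm (U u) = 1" for u
    using that by (intro sep hull_inc) (auto simp: S_def contacts_def)
  \<comment> \<open>\<open>R\<close> contains no contact point, so by compactness
    \<open>norm (U w)\<close> stays below one on it by a fixed \<open>\<eta>\<close>.\<close>
  define R where "R = sphere 0 1 \<inter> {w. c \<bullet> w\<^sup>2 \<le> b}"
  have "closed {w. c \<bullet> w\<^sup>2 \<le> b}" by (intro closed_Collect_le continuous_intros)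
  then have R: "compact R" unfolding R_def by (intro compact_Int_closed compact_sphere)
  have lt: "norm (U w) < 1" if "w \<in> R" for w
  proof -
    have "norm w = 1" "c \<bullet> w\<^sup>2 \<le> b" using that by (auto simp: R_def)
    then have "norm (U w) \<le> 1" "norm (U w) \<noteq> 1" using le[of w] far[of w] by (auto simp: U_def)
    then show ?thesis by simp
  qed
  have "\<exists>\<eta>. 0 < \<eta> \<and> \<eta> \<le> 1 \<and> (\<forall>w\<in>R. norm (U w) \<le> 1 - \<eta>)"
  proof (cases "R = {}")
    case False
    obtain w\<^sub>1 where "w\<^sub>1 \<in> R" "\<And>w. w \<in> R \<Longrightarrow> norm (U w) \<le> norm (U w\<^sub>1)"
      using continuous_attains_sup[OF R False contU] by blast
    then show ?thesis using lt by (intro exI[of _ "1 - norm (U w\<^sub>1)"]) auto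
  qed (auto intro: exI[of _ 1])
  then obtain \<eta> where \<eta>: "0 < \<eta>" "\<eta> \<le> 1" "\<And>w. w \<in> R \<Longrightarrow> norm (U w) \<le> 1 - \<eta>" by blast
  define k where "k = norm c"
  have k: "0 < k" using c by (simp add: k_def)
  \<comment> \<open>The first bound keeps the perturbation below \<open>\<eta> / 4\<close> on
    \<open>R\<close>; the second makes the gain \<open>2 * \<epsilon> * b\<close> off
    \<open>R\<close> exceed the second-order terms
    \<open>2 * (\<epsilon> * k)\<^sup>2\<close>.\<close>
  define \<epsilon> where "\<epsilon> = min (\<eta> / (4 * k)) (b / (2 * k\<^sup>2))"
  have \<epsilon>: "0 < \<epsilon>" using \<eta> b k by (simp add: \<epsilon>_def)
  have "\<epsilon> * k \<le> \<eta> / (4 * k) * k" "\<epsilon> * k\<^sup>2 \<le> b / (2 * k\<^sup>2) * k\<^sup>2"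
    unfolding \<epsilon>_def using k by (intro mult_right_mono; simp)+
  then have \<epsilon>k: "\<epsilon> * k \<le> \<eta> / 4" "\<epsilon> * k\<^sup>2 \<le> b / 2" using k by simp_all
  \<comment> \<open>\<open>T\<close> will bound the squared norm of \<open>U\<close> after the
    perturbation \<open>A\<close>, whose determinant is \<open>1 - (\<epsilon> * k)\<^sup>2\<close>.
    A smaller \<open>T\<close> contradicts maximality.\<close>
  define T where "T = max ((1 - 3 * \<eta> / 4)\<^sup>2) (1 + (\<epsilon> * k)\<^sup>2 - 2 * \<epsilon> * b)"
  have "(1 - 3 * \<eta> / 4)\<^sup>2 > 0" using \<eta> by simp
  then have T0: "0 < T" unfolding T_def by (simp add: less_max_iff_disj)
  have "(1 - 3 * \<eta> / 4)\<^sup>2 < 1 - (\<epsilon> * k)\<^sup>2"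
  proof -
    have "(\<epsilon> * k)\<^sup>2 \<le> (\<eta> / 4)\<^sup>2" using \<epsilon>k \<epsilon> k by (intro power_mono) auto
    moreover have "\<eta>\<^sup>2 \<le> \<eta>" using \<eta> by (simp add: power2_eq_square mult_left_le)
    moreover have "(1 - 3 * \<eta> / 4)\<^sup>2 = 1 - 3 / 2 * \<eta> + 9 / 16 * \<eta>\<^sup>2" "(\<eta> / 4)\<^sup>2 = \<eta>\<^sup>2 / 16"
      by (simp_all add: power2_eq_square algebra_simps)
    ultimately show ?thesis using \<eta>(1) by argo
  qed
  moreover have "1 + (\<epsilon> * k)\<^sup>2 - 2 * \<epsilon> * b < 1 - (\<epsilon> * k)\<^sup>2"
  proof -
    have "\<epsilon> * (\<epsilon> * k\<^sup>2) \<le> \<epsilon> * (b / 2)" using \<epsilon>k(2) \<epsilon> by (intro mult_left_mono) auto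
    moreover have "0 < \<epsilon> * b" using \<epsilon> b by simp
    ultimately show ?thesis by (simp add: power2_eq_square algebra_simps)
  qed
  ultimately have T1: "T < 1 - (\<epsilon> * k)\<^sup>2" by (simp add: T_def)
  \<comment> \<open>To first order \<open>A\<close> changes the squared norm by
    \<open>- 2 * \<epsilon> * (c \<bullet> w\<^sup>2)\<close>, a decrease at every contact
    point.\<close>
  define A where "A = (\<lambda>w. w - \<epsilon> * c * cnj w)"
  have normA: "(norm (A w))\<^sup>2 = (1 + (\<epsilon> * k)\<^sup>2) * (norm w)\<^sup>2 - 2 * \<epsilon> * (c \<bullet> w\<^sup>2)" for w
    unfolding A_def k_def power_mult_distrib cmod_power2 inner_complex_def
    by (simp add: power2_eq_square algebra_simps)
  have bound1: "norm (U (A w)) \<le> sqrt T" if w: "norm w = 1" for w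
  proof (rule real_le_rsqrt)
    show "(norm (U (A w)))\<^sup>2 \<le> T"
    proof (cases "w \<in> R")
      case True
      have "U (A w) = U w - U (\<epsilon> * c * cnj w)"
        unfolding U_def A_def linear_diff[OF W, symmetric] by (simp add: algebra_simps)
      then have "norm (U (A w)) \<le> norm (U w) + norm (U (\<epsilon> * c * cnj w))"
        by (simp add: norm_triangle_ineq4)
      also have "\<dots> \<le> (1 - \<eta>) + \<epsilon> * k"
        using \<eta>(3)[OF True] le[of "\<epsilon> * c * cnj w"] w \<epsilon> by (simp add: U_def k_def norm_mult)
      also have "\<dots> \<le> 1 - 3 * \<eta> / 4" using \<epsilon>k by simp
      finally have "(norm (U (A w)))\<^sup>2 \<le> (1 - 3 * \<eta> / 4)\<^sup>2" by (intro power_mono) auto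
      then show ?thesis by (simp add: T_def)
    next
      case False
      then have "b \<le> c \<bullet> w\<^sup>2" using w by (simp add: R_def)
      then have "\<epsilon> * b \<le> \<epsilon> * (c \<bullet> w\<^sup>2)" using \<epsilon> by (intro mult_left_mono) auto
      moreover have "(norm (U (A w)))\<^sup>2 \<le> (norm (A w))\<^sup>2"
        using le by (intro power_mono) (auto simp: U_def)
      ultimately show ?thesis using w by (simp add: normA T_def le_max_iff_disj)
    qed
  qed
  have bound: "norm (U (A w)) \<le> sqrt T * norm w" for w
  proof (cases "w = 0")
    case False
    define v where "v = inverse (norm w) *\<^sub>R w"
    have "norm v = 1" "w = norm w *\<^sub>R v" using False by (simp_all add: v_def)
    have "A (t *\<^sub>R v) = t *\<^sub>R A v" for t by (simp add: A_def scaleR_conv_of_real algebra_simps)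
    then have "A w = norm w *\<^sub>R A v" using \<open>w = norm w *\<^sub>R v\<close> by metis
    then have "U (A w) = U (norm w *\<^sub>R A v)" by simp
    also have "\<dots> = norm w *\<^sub>R U (A v)"
      unfolding U_def linear_cmul[OF W, symmetric]
      by (rule arg_cong[of _ _ W]) (simp add: scaleR_conv_of_real algebra_simps)
    finally have "U (A w) = norm w *\<^sub>R U (A v)" .
    then show ?thesis using bound1[OF \<open>norm v = 1\<close>] by (simp add: mult.commute[of "sqrt T"] mult_left_mono)
  qed (simp add: U_def A_def linear_0[OF W])
  \<comment> \<open>These are the coefficients after composing with \<open>A\<close>, so their
    determinant is the product of the two determinants.\<close>
  define \<alpha>' \<beta>' where "\<alpha>' = \<alpha> - \<epsilon> * \<beta> * cnj c" and "\<beta>' = \<beta> - \<epsilon> * \<alpha> * c"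
  have "U (A w) = W (\<alpha>' * w + \<beta>' * cnj w)" for w
    by (simp add: U_def A_def \<alpha>'_def \<beta>'_def algebra_simps)
  then have "(norm \<alpha>')\<^sup>2 - (norm \<beta>')\<^sup>2 \<le> (sqrt T)\<^sup>2 * ((norm \<alpha>)\<^sup>2 - (norm \<beta>)\<^sup>2)"
    using bound T0 by (intro max) simp_all
  moreover have "(norm \<alpha>')\<^sup>2 - (norm \<beta>')\<^sup>2 = (1 - (\<epsilon> * k)\<^sup>2) * ((norm \<alpha>)\<^sup>2 - (norm \<beta>)\<^sup>2)"
    unfolding \<alpha>'_def \<beta>'_def k_def power_mult_distrib cmod_power2
    by (simp add: power2_eq_square algebra_simps)
  ultimately show False using T0 T1 pos by simp
qed

text \<open>On the plane a support functional at \<open>U u\<close> is the inner product with some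
  \<open>v\<close> such that \<open>norm v \<le> 1\<close> and \<open>v \<bullet> u = 1\<close>;
  equality in Cauchy-Schwarz forces \<open>v = u\<close>. Geometrically, ball and ellipse share
  their tangent at a contact point.\<close>

lemma contact_functional:
  fixes U :: "complex \<Rightarrow> 'a::real_normed_vector"
  assumes U: "linear U" and le: "\<And>w. norm (U w) \<le> norm w" and u: "u \<in> contacts U"
  obtains g where "linear g" "\<And>x. \<bar>g x\<bar> \<le> norm x" "\<And>w. g (U w) = u \<bullet> w"
proof -
  obtain g where g: "linear g" "\<And>x. \<bar>g x\<bar> \<le> norm x" "g (U u) = norm (U u)"
    using support_functional[of "U u"] by blast
  define v where "v = Complex (g (U 1)) (g (U \<i>))"
  have gU: "g (U w) = v \<bullet> w" for w
  proof -
    have "U w = U (Re w *\<^sub>R 1 + Im w *\<^sub>R \<i>)"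
      by (rule arg_cong[of _ _ U]) (simp add: complex_eq_iff)
    then show ?thesis
      by (simp add: linear_add linear_cmul U g(1) v_def inner_complex_def)
  qed
  have "norm v * norm v \<le> norm v * 1"
    using g(2)[of "U v"] le[of v] by (simp add: gU power2_norm_eq_inner[symmetric] power2_eq_square)
  then have "norm v \<le> 1" by (metis less_eq_real_def mult_le_cancel_left norm_ge_zero not_less zero_le_one)
  then have "(norm v)\<^sup>2 \<le> 1" by (simp add: power_le_one)
  moreover have "norm u = 1" "v \<bullet> u = 1" using g(3) u by (simp_all add: gU contacts_def)
  moreover have "(norm (v - u))\<^sup>2 = (norm v)\<^sup>2 - 2 * (v \<bullet> u) + (norm u)\<^sup>2"
    by (simp add: power2_norm_eq_inner inner_diff_left inner_diff_right inner_commute)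
  ultimately have "(norm (v - u))\<^sup>2 \<le> 0" by simp
  then have "v = u" by simp
  then show thesis using g gU that by blast
qed

section \<open>Unit complex numbers and their squares\<close>

text \<open>The projection onto the line of \<open>u\<close> is the mean of the identity and a
  reflection. Weighted sums of such projections therefore depend only on the squares of the unit
  vectors.\<close>

lemma inner_scaleR_unit_complex:
  fixes u w :: complex
  assumes "norm u = 1"
  shows "(u \<bullet> w) *\<^sub>R u = (w + u\<^sup>2 * cnj w) / 2"
proof -
  have "(Re u)\<^sup>2 + (Im u)\<^sup>2 = 1" using assms by (simp add: cmod_def)
  then have "Re w = Re w * ((Re u)\<^sup>2 + (Im u)\<^sup>2)" "Im w = Im w * ((Re u)\<^sup>2 + (Im u)\<^sup>2)" by simp_all
  then show ?thesis
    by (simp add: complex_eq_iff inner_complex_def power2_eq_square algebra_simps)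
qed

text \<open>The double-angle formula for the squared cosine.\<close>

lemma inner_squared_unit_complex:
  fixes u v :: complex
  assumes "norm u = 1" "norm v = 1"
  shows "(u \<bullet> v)\<^sup>2 = (1 + u\<^sup>2 \<bullet> v\<^sup>2) / 2"
proof -
  have "(u \<bullet> v)\<^sup>2 = ((u \<bullet> v) *\<^sub>R u) \<bullet> v" by (simp add: power2_eq_square)
  also have "\<dots> = (v \<bullet> v + (u\<^sup>2 * cnj v) \<bullet> v) / 2"
    unfolding inner_scaleR_unit_complex[OF assms(1)]
    by (simp add: inner_add_left flip: scaleR_half_double) (simp add: inner_complex_def field_simps)
  also have "(u\<^sup>2 * cnj v) \<bullet> v = u\<^sup>2 \<bullet> v\<^sup>2"
    by (simp add: inner_complex_def power2_eq_square algebra_simps)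
  also have "v \<bullet> v = 1" using assms(2) by (simp add: norm_eq_1)
  finally show ?thesis .
qed

text \<open>Multiplication by \<open>cnj r\<close> rotates \<open>r\<close> to \<open>1\<close>, and
  hence \<open>p\<close> and \<open>q\<close> to \<open>\<i>\<close> or
  \<open>- \<i>\<close>.\<close>

lemma orthogonal_unit_complex:
  fixes p q r :: complex
  assumes "norm p = 1" "norm q = 1" "norm r = 1" "p \<bullet> r = 0" "q \<bullet> r = 0"
  shows "p = q \<or> p = - q"
proof -
  have r: "cnj r * r = 1" using assms(3) complex_norm_square[of r] by (simp add: mult.commute)
  have im: "Re (z * cnj r) = 0" "\<bar>Im (z * cnj r)\<bar> = 1" if "norm z = 1" "z \<bullet> r = 0" for z
  proof -
    show re: "Re (z * cnj r) = 0" using that(2) by (simp add: inner_complex_def)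
    have "norm (z * cnj r) = 1" using that(1) assms(3) by (simp add: norm_mult)
    then show "\<bar>Im (z * cnj r)\<bar> = 1" unfolding cmod_eq_Im[OF re] .
  qed
  have "p * cnj r = q * cnj r \<or> p * cnj r = - q * cnj r"
    using im[of p] im[of q] assms by (auto simp: complex_eq_iff abs_if split: if_splits)
  then have "p * (cnj r * r) = q * (cnj r * r) \<or> p * (cnj r * r) = - q * (cnj r * r)"
    by (metis mult.assoc)
  then show ?thesis by (simp add: r)
qed

text \<open>Project the operator \<open>x \<mapsto> (\<surd>c\<^sub>j g\<^sub>j x)\<^sub>j\<close> given by John's condition to the plane.  The
  result still has Hilbert--Schmidt norm one on the ellipse, but its norm is less than one
  unless the contact points lie on two orthogonal lines.\<close>

lemma two_summing_orthogonal_contacts: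
  fixes U :: "complex \<Rightarrow> 'a::banach"
  assumes two: "two_summing_property TYPE('a)"
    and U: "linear U" and le: "\<And>w. norm (U w) \<le> norm w"
    and john: "0 \<in> convex hull ((\<lambda>u. u\<^sup>2) ` contacts U)"
  obtains u where "u \<in> contacts U" "\<i> * u \<in> contacts U"
proof -
  obtain s l where s: "finite s" "s \<subseteq> (\<lambda>u. u\<^sup>2) ` contacts U" and l: "\<And>\<sigma>. \<sigma> \<in> s \<Longrightarrow> 0 \<le> l \<sigma>"
    "sum l s = 1" "(\<Sum>\<sigma>\<in>s. l \<sigma> *\<^sub>R \<sigma>) = 0"
    using john unfolding convex_hull_explicit by auto
  have "\<exists>u. \<sigma> \<in> s \<longrightarrow> u \<in> contacts U \<and> u\<^sup>2 = \<sigma>" for \<sigma> using s(2) by blast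
  then obtain f where f: "\<And>\<sigma>. \<sigma> \<in> s \<Longrightarrow> f \<sigma> \<in> contacts U" "\<And>\<sigma>. \<sigma> \<in> s \<Longrightarrow> (f \<sigma>)\<^sup>2 = \<sigma>" by metis
  have f1: "norm (f \<sigma>) = 1" if "\<sigma> \<in> s" for \<sigma> using f(1)[OF that] by (simp add: contacts_def)
  have "\<exists>g. \<sigma> \<in> s \<longrightarrow> linear g \<and> (\<forall>x. \<bar>g x\<bar> \<le> norm x) \<and> (\<forall>w. g (U w) = f \<sigma> \<bullet> w)" for \<sigma>
    using contact_functional[OF U le f(1)] by metis
  then obtain g where g: "\<And>\<sigma>. \<sigma> \<in> s \<Longrightarrow> linear (g \<sigma>)" "\<And>\<sigma> x. \<sigma> \<in> s \<Longrightarrow> \<bar>g \<sigma> x\<bar> \<le> norm x"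
    "\<And>\<sigma> w. \<sigma> \<in> s \<Longrightarrow> g \<sigma> (U w) = f \<sigma> \<bullet> w" by metis
  define T where "T = (\<lambda>x. \<Sum>\<sigma>\<in>s. (l \<sigma> * g \<sigma> x) *\<^sub>R f \<sigma>)"
  \<comment> \<open>The resolution of the identity: the reflection parts cancel by John's condition,
    and weights of sum one leave half the identity.\<close>
  have frame: "(\<Sum>\<sigma>\<in>s. (l \<sigma> * (f \<sigma> \<bullet> w)) *\<^sub>R f \<sigma>) = w / 2" for w
  proof -
    have "(\<Sum>\<sigma>\<in>s. (l \<sigma> * (f \<sigma> \<bullet> w)) *\<^sub>R f \<sigma>) = (\<Sum>\<sigma>\<in>s. (l \<sigma> *\<^sub>R w + (l \<sigma> *\<^sub>R \<sigma>) * cnj w) / 2)"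
    proof (rule sum.cong[OF refl])
      fix \<sigma> assume "\<sigma> \<in> s"
      then show "(l \<sigma> * (f \<sigma> \<bullet> w)) *\<^sub>R f \<sigma> = (l \<sigma> *\<^sub>R w + (l \<sigma> *\<^sub>R \<sigma>) * cnj w) / 2"
        using inner_scaleR_unit_complex[OF f1, of \<sigma> w] f(2)
        by (simp add: scaleR_scaleR[symmetric] del: scaleR_scaleR) (simp add: scaleR_conv_of_real algebra_simps)
    qed
    also have "\<dots> = (sum l s *\<^sub>R w + (\<Sum>\<sigma>\<in>s. l \<sigma> *\<^sub>R \<sigma>) * cnj w) / 2"
      by (simp add: sum.distrib scaleR_left.sum sum_distrib_right flip: sum_divide_distrib)
    finally show ?thesis by (simp add: l)
  qed
  have TU: "T (U w) = w / 2" for w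
    unfolding T_def frame[symmetric] using g(3) by (intro sum.cong) auto
  have bl: "bounded_linear T"
    unfolding T_def
    by (intro bounded_linear_sum bounded_linear_scaleR_const bounded_linear_const_mult
        bounded_linear_functional g)
  \<comment> \<open>The maximum of \<open>F\<close> on the circle bounds the norm of
    \<open>T\<close>, by pairing \<open>T x\<close> with its own direction.\<close>
  define F where "F = (\<lambda>v. \<Sum>\<sigma>\<in>s. l \<sigma> * \<bar>f \<sigma> \<bullet> v\<bar>)"
  have "continuous_on (sphere 0 1) F" unfolding F_def by (intro continuous_intros)
  moreover have "sphere (0 :: complex) 1 \<noteq> {}" by simp
  ultimately obtain v where v: "v \<in> sphere 0 1" "\<And>w. w \<in> sphere 0 1 \<Longrightarrow> F w \<le> F v"
    using continuous_attains_sup[OF compact_sphere] by metis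
  have v1: "norm v = 1" using v(1) by simp
  have F0: "0 \<le> F w" for w unfolding F_def using l(1) by (intro sum_nonneg) auto
  have normT: "norm (T x) \<le> F v * norm x" for x
  proof (cases "T x = 0")
    case False
    define w where "w = sgn (T x)"
    have "norm (T x) = T x \<bullet> w"
      using False by (simp add: w_def sgn_div_norm power2_norm_eq_inner[symmetric] power2_eq_square)
    also have "\<dots> = (\<Sum>\<sigma>\<in>s. l \<sigma> * g \<sigma> x * (f \<sigma> \<bullet> w))" by (simp add: T_def inner_sum_left)
    also have "\<dots> \<le> (\<Sum>\<sigma>\<in>s. l \<sigma> * \<bar>f \<sigma> \<bullet> w\<bar> * norm x)"
    proof (rule sum_mono)
      fix \<sigma> assume \<sigma>: "\<sigma> \<in> s"
      have "g \<sigma> x * (f \<sigma> \<bullet> w) \<le> \<bar>g \<sigma> x\<bar> * \<bar>f \<sigma> \<bullet> w\<bar>" by (metis abs_ge_self abs_mult)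
      also have "\<dots> \<le> norm x * \<bar>f \<sigma> \<bullet> w\<bar>" using g(2)[OF \<sigma>] by (intro mult_right_mono) auto
      finally show "l \<sigma> * g \<sigma> x * (f \<sigma> \<bullet> w) \<le> l \<sigma> * \<bar>f \<sigma> \<bullet> w\<bar> * norm x"
        by (auto simp: mult_ac dest: mult_left_mono[OF _ l(1)[OF \<sigma>]])
    qed
    also have "\<dots> = F w * norm x" by (simp add: F_def sum_distrib_right)
    also have "\<dots> \<le> F v * norm x"
      using False by (intro mult_right_mono v(2)) (simp_all add: w_def norm_sgn)
    finally show ?thesis .
  qed (simp add: F0)
  \<comment> \<open>On the ellipse \<open>T\<close> is half the identity, so the left side is
    \<open>1 / 2\<close> and \<open>F v\<close> is at least \<open>sqrt (1 / 2)\<close>.\<close>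
  have "(Re (T (U 1)))\<^sup>2 + (Im (T (U 1)))\<^sup>2 + ((Re (T (U \<i>)))\<^sup>2 + (Im (T (U \<i>)))\<^sup>2) \<le> (F v)\<^sup>2"
  proof (rule two_summing_rank_two[OF two])
    show "bounded_linear (\<lambda>x. Re (T x))" "bounded_linear (\<lambda>x. Im (T x))"
      using bounded_linear_compose[OF bounded_linear_Re bl] bounded_linear_compose[OF bounded_linear_Im bl] .
    fix a b
    have "a *\<^sub>R U 1 + b *\<^sub>R U \<i> = U (Complex a b)"
      unfolding linear_cmul[OF U, symmetric] linear_add[OF U, symmetric]
      by (rule arg_cong[of _ _ U]) (simp add: complex_eq_iff)
    moreover have "(norm (U (Complex a b)))\<^sup>2 \<le> (norm (Complex a b))\<^sup>2" using le by (intro power_mono) auto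
    ultimately show "(norm (a *\<^sub>R U 1 + b *\<^sub>R U \<i>))\<^sup>2 \<le> a\<^sup>2 + b\<^sup>2" by (simp add: cmod_power2)
  next
    fix x
    have "(norm (T x))\<^sup>2 \<le> (F v * norm x)\<^sup>2" using normT by (intro power_mono) auto
    then show "(Re (T x))\<^sup>2 + (Im (T x))\<^sup>2 \<le> (F v)\<^sup>2 * (norm x)\<^sup>2"
      by (simp add: cmod_power2 power_mult_distrib)
  qed simp
  then have "(1 / 2)\<^sup>2 + (1 / 2)\<^sup>2 \<le> (F v)\<^sup>2" by (simp add: TU)
  moreover define r where "r = sqrt (1 / 2)"
  moreover have r: "r\<^sup>2 = 1 / 2" "0 < r" by (simp_all add: r_def)
  ultimately have "r\<^sup>2 \<le> (F v)\<^sup>2" by (simp add: power2_eq_square)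
  then have rF: "r \<le> F v" using F0 by (rule power2_le_imp_le)
  have "(\<Sum>\<sigma>\<in>s. l \<sigma> * (f \<sigma> \<bullet> v)\<^sup>2) = (\<Sum>\<sigma>\<in>s. (l \<sigma> * (f \<sigma> \<bullet> v)) *\<^sub>R f \<sigma>) \<bullet> v"
    by (simp add: inner_sum_left power2_eq_square mult.assoc)
  also have "\<dots> = (v \<bullet> v) / 2" unfolding frame by (simp add: inner_complex_def field_simps)
  also have "\<dots> = 1 / 2" using v1 by (simp add: norm_eq_1)
  finally have second: "(\<Sum>\<sigma>\<in>s. l \<sigma> * (f \<sigma> \<bullet> v)\<^sup>2) = 1 / 2" .
  \<comment> \<open>A variance argument: under the weights \<open>l\<close> the values
    \<open>\<bar>f \<sigma> \<bullet> v\<bar>\<close> have mean square \<open>r\<^sup>2\<close> and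
    mean at least \<open>r\<close>, so all those of positive weight equal \<open>r\<close>.\<close>
  have "(\<Sum>\<sigma>\<in>s. l \<sigma> * (\<bar>f \<sigma> \<bullet> v\<bar> - r)\<^sup>2)
      = (\<Sum>\<sigma>\<in>s. l \<sigma> * (f \<sigma> \<bullet> v)\<^sup>2 - 2 * r * (l \<sigma> * \<bar>f \<sigma> \<bullet> v\<bar>) + r\<^sup>2 * l \<sigma>)"
    by (intro sum.cong) (simp_all add: power2_diff algebra_simps)
  also have "\<dots> = 1 - 2 * (r * F v)"
    by (simp add: sum.distrib sum_subtractf second l(2) F_def r
        flip: sum_distrib_left sum_divide_distrib)
  also have "\<dots> \<le> 0"
  proof -
    have "r * r \<le> r * F v" using rF r by (intro mult_left_mono) auto
    then show ?thesis using r(1) unfolding power2_eq_square by simp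
  qed
  finally have "(\<Sum>\<sigma>\<in>s. l \<sigma> * (\<bar>f \<sigma> \<bullet> v\<bar> - r)\<^sup>2) = 0"
    using l(1) by (intro antisym sum_nonneg) auto
  then have zero: "\<forall>\<sigma>\<in>s. l \<sigma> * (\<bar>f \<sigma> \<bullet> v\<bar> - r)\<^sup>2 = 0"
    using s(1) l(1) by (subst (asm) sum_nonneg_eq_0_iff) auto
  have orth: "\<sigma> \<bullet> v\<^sup>2 = 0" if "\<sigma> \<in> s" "l \<sigma> \<noteq> 0" for \<sigma>
  proof -
    have "\<bar>f \<sigma> \<bullet> v\<bar>\<^sup>2 = r\<^sup>2" using zero that by auto
    then show ?thesis
      using inner_squared_unit_complex[OF f1[OF that(1)] v1] f(2)[OF that(1)] r(1) by simp
  qed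
  have s1: "norm \<sigma> = 1" if "\<sigma> \<in> s" for \<sigma>
    using f1[OF that] f(2)[OF that] by (metis norm_power power_one)
  obtain \<sigma>\<^sub>1 where \<sigma>1: "\<sigma>\<^sub>1 \<in> s" "l \<sigma>\<^sub>1 \<noteq> 0" using l(2) by (metis sum.neutral zero_neq_one)
  \<comment> \<open>The squares of positive weight cannot all coincide, since their weighted mean is
    zero and each has norm one.\<close>
  have "\<exists>\<sigma>\<in>s. l \<sigma> \<noteq> 0 \<and> \<sigma> \<noteq> \<sigma>\<^sub>1"
  proof (rule ccontr)
    assume "\<not> ?thesis"
    then have "(\<Sum>\<sigma>\<in>s. l \<sigma> *\<^sub>R \<sigma>) = (\<Sum>\<sigma>\<in>s. l \<sigma> *\<^sub>R \<sigma>\<^sub>1)" by (intro sum.cong) auto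
    also have "\<dots> = \<sigma>\<^sub>1" using l(2) by (simp flip: scaleR_left.sum)
    finally show False using l(3) s1[OF \<sigma>1(1)] by auto
  qed
  then obtain \<sigma>\<^sub>2 where \<sigma>2: "\<sigma>\<^sub>2 \<in> s" "l \<sigma>\<^sub>2 \<noteq> 0" "\<sigma>\<^sub>2 \<noteq> \<sigma>\<^sub>1" by blast
  have "norm (v\<^sup>2) = 1" using v1 by (simp add: norm_power)
  \<comment> \<open>Distinct unit vectors orthogonal to \<open>v\<^sup>2\<close> are opposite, and
    square roots of opposite numbers differ by the factor \<open>\<i>\<close> up to sign.\<close>
  then have "\<sigma>\<^sub>2 = - \<sigma>\<^sub>1"
    using orthogonal_unit_complex[of \<sigma>\<^sub>2 \<sigma>\<^sub>1 "v\<^sup>2"] s1 \<sigma>1 \<sigma>2 orth by blast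
  then have "(f \<sigma>\<^sub>2)\<^sup>2 = (\<i> * f \<sigma>\<^sub>1)\<^sup>2" using f(2) \<sigma>1 \<sigma>2 by (simp add: power_mult_distrib)
  then have eq: "\<i> * f \<sigma>\<^sub>1 = f \<sigma>\<^sub>2 \<or> \<i> * f \<sigma>\<^sub>1 = - f \<sigma>\<^sub>2" by (metis power2_eq_iff)
  show thesis
  proof (rule that)
    show "f \<sigma>\<^sub>1 \<in> contacts U" by (rule f(1)[OF \<sigma>1(1)])
    show "\<i> * f \<sigma>\<^sub>1 \<in> contacts U"
      using eq f(1)[OF \<sigma>2(1)] linear_neg[OF U] by (auto simp: contacts_def)
  qed
qed

section \<open>Planar sections of a space with the property\<close>

text \<open>Stated for arbitrary \<open>x\<close> and \<open>y\<close>: if they are dependent, one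
  of the two forms is taken to be zero. Otherwise the forms are the coordinates with respect to two
  orthogonal contact points, where \<open>two_summing_square\<close> applies.\<close>

theorem two_summing_plane_section:
  fixes x y :: "'a::banach"
  assumes two: "two_summing_property TYPE('a)"
  shows "\<exists>\<alpha> \<beta> \<gamma> \<delta>. \<forall>a b. norm (a *\<^sub>R x + b *\<^sub>R y) = max \<bar>\<alpha> * a + \<beta> * b\<bar> \<bar>\<gamma> * a + \<delta> * b\<bar>"
proof (cases "\<exists>a b. (a, b) \<noteq> (0, 0) \<and> a *\<^sub>R x + b *\<^sub>R y = 0")
  case True
  then obtain a b where ab: "a \<noteq> 0 \<or> b \<noteq> 0" "a *\<^sub>R x = (- b) *\<^sub>R y" by (auto simp: eq_neg_iff_add_eq_0)
  have "\<exists>v p q. x = p *\<^sub>R v \<and> y = q *\<^sub>R v"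
  proof (cases "a = 0")
    case True
    then show ?thesis using ab by (intro exI[of _ x] exI[of _ 1] exI[of _ 0]) auto
  next
    case False
    have "x = inverse a *\<^sub>R (a *\<^sub>R x)" using False by simp
    also have "\<dots> = (- b / a) *\<^sub>R y" unfolding ab(2) by (simp add: field_simps)
    finally show ?thesis by (intro exI[of _ y] exI[of _ "- b / a"] exI[of _ 1]) auto
  qed
  then obtain v p q where "x = p *\<^sub>R v" "y = q *\<^sub>R v" by blast
  then have "norm (a *\<^sub>R x + b *\<^sub>R y) = \<bar>(p * norm v) * a + (q * norm v) * b\<bar>" for a b
  proof -
    have "a *\<^sub>R x + b *\<^sub>R y = (p * a + q * b) *\<^sub>R v"
      using \<open>x = _\<close> \<open>y = _\<close> by (simp add: scaleR_add_left mult.commute)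
    moreover have "(p * norm v) * a + (q * norm v) * b = (p * a + q * b) * norm v" by (simp add: algebra_simps)
    ultimately show ?thesis by (simp add: abs_mult)
  qed
  then show ?thesis by (intro exI[of _ "p * norm v"] exI[of _ "q * norm v"] exI[of _ 0]) simp
next
  case False
  define W where "W = (\<lambda>z. Re z *\<^sub>R x + Im z *\<^sub>R y)"
  have W: "linear W" by (intro linearI) (simp_all add: W_def algebra_simps)
  have inj: "z = 0" if "W z = 0" for z
    using False that by (auto simp: W_def complex_eq_iff)
  obtain \<alpha> \<beta> where le: "\<And>w. norm (W (\<alpha> * w + \<beta> * cnj w)) \<le> norm w"
    and pos: "0 < (norm \<alpha>)\<^sup>2 - (norm \<beta>)\<^sup>2"
    and max: "\<And>\<alpha>' \<beta>' t. 0 < t \<Longrightarrow> (\<And>w. norm (W (\<alpha>' * w + \<beta>' * cnj w)) \<le> t * norm w) \<Longrightarrow>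
      (norm \<alpha>')\<^sup>2 - (norm \<beta>')\<^sup>2 \<le> t\<^sup>2 * ((norm \<alpha>)\<^sup>2 - (norm \<beta>)\<^sup>2)"
    using maximal_ellipse[OF W inj] by blast
  define U where "U = (\<lambda>w. W (\<alpha> * w + \<beta> * cnj w))"
  have U: "linear U"
    unfolding U_def by (intro linear_compose[OF _ W, unfolded o_def] linearI) (simp_all add: algebra_simps)
  have leU: "norm (U w) \<le> norm w" for w unfolding U_def by (rule le)
  have "0 \<in> convex hull ((\<lambda>u. u\<^sup>2) ` contacts U)"
    unfolding U_def by (rule john_contacts[OF W le pos max])
  then obtain u where u: "u \<in> contacts U" "\<i> * u \<in> contacts U"
    using two_summing_orthogonal_contacts[OF two U leU] by blast
  obtain g\<^sub>1 where g1: "linear g\<^sub>1" "\<And>x. \<bar>g\<^sub>1 x\<bar> \<le> norm x" "\<And>w. g\<^sub>1 (U w) = u \<bullet> w"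
    using contact_functional[OF U leU u(1)] by blast
  obtain g\<^sub>2 where g2: "linear g\<^sub>2" "\<And>x. \<bar>g\<^sub>2 x\<bar> \<le> norm x" "\<And>w. g\<^sub>2 (U w) = (\<i> * u) \<bullet> w"
    using contact_functional[OF U leU u(2)] by blast
  have "norm u = 1" using u by (simp add: contacts_def)
  then have u1: "(Re u)\<^sup>2 + (Im u)\<^sup>2 = 1" by (simp add: cmod_def)
  have square: "norm (a *\<^sub>R U u + b *\<^sub>R U (\<i> * u)) = max \<bar>a\<bar> \<bar>b\<bar>" for a b
  proof (rule two_summing_square[OF two _ g1(1,2) g2(1,2)])
    fix a b
    have "norm (a *\<^sub>R U u + b *\<^sub>R U (\<i> * u)) \<le> norm (a *\<^sub>R u + b *\<^sub>R (\<i> * u))"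
      using leU unfolding linear_cmul[OF U, symmetric] linear_add[OF U, symmetric] .
    then have "(norm (a *\<^sub>R U u + b *\<^sub>R U (\<i> * u)))\<^sup>2 \<le> (norm (a *\<^sub>R u + b *\<^sub>R (\<i> * u)))\<^sup>2"
      by (intro power_mono) auto
    also have "a *\<^sub>R u + b *\<^sub>R (\<i> * u) = Complex a b * u" by (simp add: complex_eq_iff)
    also have "(norm \<dots>)\<^sup>2 = a\<^sup>2 + b\<^sup>2"
      using \<open>norm u = 1\<close> by (simp add: norm_mult cmod_power2)
    finally show "(norm (a *\<^sub>R U u + b *\<^sub>R U (\<i> * u)))\<^sup>2 \<le> a\<^sup>2 + b\<^sup>2" .
  qed (use u1 in \<open>simp_all add: g1(3) g2(3) inner_complex_def power2_eq_square\<close>)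
  define D where "D = complex_of_real ((norm \<alpha>)\<^sup>2 - (norm \<beta>)\<^sup>2)"
  have D: "D \<noteq> 0" "cnj D = D" "\<alpha> * cnj \<alpha> - \<beta> * cnj \<beta> = D"
    using pos unfolding D_def of_real_eq_0_iff by (simp_all only: of_real_diff complex_norm_square) simp_all
  \<comment> \<open>The inverse of the map with coefficients \<open>\<alpha>\<close> and
    \<open>\<beta>\<close>, whose determinant is \<open>D\<close>.\<close>
  define V where "V = (\<lambda>z. (cnj \<alpha> * z - \<beta> * cnj z) / D)"
  have WV: "W z = U (V z)" for z
  proof -
    have "\<alpha> * V z + \<beta> * cnj (V z) = (\<alpha> * cnj \<alpha> - \<beta> * cnj \<beta>) * z / D"
      unfolding V_def by (simp add: D(2) algebra_simps flip: add_divide_distrib diff_divide_distrib)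
    also have "\<dots> = z" unfolding D(3) using D(1) by simp
    finally show ?thesis by (simp add: U_def)
  qed
  have dec: "U w = (u \<bullet> w) *\<^sub>R U u + ((\<i> * u) \<bullet> w) *\<^sub>R U (\<i> * u)" for w
  proof -
    have "w = ((Re u)\<^sup>2 + (Im u)\<^sup>2) *\<^sub>R w" by (simp add: u1)
    also have "\<dots> = (u \<bullet> w) *\<^sub>R u + ((\<i> * u) \<bullet> w) *\<^sub>R (\<i> * u)"
      by (simp add: complex_eq_iff inner_complex_def power2_eq_square algebra_simps)
    finally show ?thesis by (metis linear_add[OF U] linear_cmul[OF U])
  qed
  have "norm (a *\<^sub>R x + b *\<^sub>R y) = max \<bar>(u \<bullet> V 1) * a + (u \<bullet> V \<i>) * b\<bar>
      \<bar>((\<i> * u) \<bullet> V 1) * a + ((\<i> * u) \<bullet> V \<i>) * b\<bar>" for a b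
  proof -
    have "a *\<^sub>R x + b *\<^sub>R y = W (Complex a b)" by (simp add: W_def)
    also have "\<dots> = U (V (Complex a b))" by (rule WV)
    also have "V (Complex a b) = a *\<^sub>R V 1 + b *\<^sub>R V \<i>"
    proof -
      have "Complex a b = of_real a + of_real b * \<i>" by (simp add: complex_eq_iff)
      then show ?thesis
        by (simp add: V_def scaleR_conv_of_real algebra_simps add_divide_distrib diff_divide_distrib)
    qed
    finally have "a *\<^sub>R x + b *\<^sub>R y = U (a *\<^sub>R V 1 + b *\<^sub>R V \<i>)" .
    then have "norm (a *\<^sub>R x + b *\<^sub>R y)
        = max \<bar>u \<bullet> (a *\<^sub>R V 1 + b *\<^sub>R V \<i>)\<bar> \<bar>(\<i> * u) \<bullet> (a *\<^sub>R V 1 + b *\<^sub>R V \<i>)\<bar>"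
      by (simp only: dec[of "a *\<^sub>R V 1 + b *\<^sub>R V \<i>"] square)
    then show ?thesis by (simp only: inner_add_right inner_scaleR_right mult.commute)
  qed
  then show ?thesis by blast
qed

section \<open>Norms whose planar sections are parallelograms\<close>

lemma abs_add_abs_diff: "\<bar>b\<bar> \<le> \<bar>a\<bar> \<Longrightarrow> \<bar>a + b\<bar> + \<bar>a - b\<bar> = 2 * \<bar>a :: real\<bar>"
  by linarith

text \<open>A form that strictly dominates at \<open>x\<close> still dominates, with unchanged sign,
  on a short segment through \<open>x\<close>, so \<open>N\<close> is affine there.\<close>

lemma parallelogram_edge_affine:
  fixes N :: "'v::real_vector \<Rightarrow> real"
  assumes N: "\<And>a b. N (a *\<^sub>R x + b *\<^sub>R y) = max \<bar>\<alpha> * a + \<beta> * b\<bar> \<bar>\<gamma> * a + \<delta> * b\<bar>"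
    and lt: "\<bar>\<gamma>\<bar> < \<bar>\<alpha>\<bar>"
  shows "\<exists>s>0. N (x + s *\<^sub>R y) + N (x - s *\<^sub>R y) = 2 * N x"
proof -
  \<comment> \<open>Up to this \<open>s\<close> the two forms together change by less than the gap
    at \<open>x\<close>; the added \<open>1\<close> keeps the denominator positive.\<close>
  define s where "s = (\<bar>\<alpha>\<bar> - \<bar>\<gamma>\<bar>) / (\<bar>\<beta>\<bar> + \<bar>\<delta>\<bar> + 1)"
  have s: "0 < s" using lt by (simp add: s_def add_nonneg_pos)
  have "s * (\<bar>\<beta>\<bar> + \<bar>\<delta>\<bar> + 1) = \<bar>\<alpha>\<bar> - \<bar>\<gamma>\<bar>"
    unfolding s_def by (simp add: add_nonneg_pos order_less_imp_not_eq2)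
  then have "\<bar>\<beta> * s\<bar> + \<bar>\<delta> * s\<bar> + s = \<bar>\<alpha>\<bar> - \<bar>\<gamma>\<bar>" using s by (simp add: abs_mult algebra_simps)
  then have le: "\<bar>\<gamma>\<bar> + \<bar>\<delta> * s\<bar> \<le> \<bar>\<alpha>\<bar> - \<bar>\<beta> * s\<bar>" using s by linarith
  have "\<bar>\<gamma> + \<delta> * s\<bar> \<le> \<bar>\<alpha> + \<beta> * s\<bar>"
    using le abs_triangle_ineq[of \<gamma> "\<delta> * s"] abs_triangle_ineq4[of "\<alpha> + \<beta> * s" "\<beta> * s"] by simp
  moreover have "\<bar>\<gamma> - \<delta> * s\<bar> \<le> \<bar>\<alpha> - \<beta> * s\<bar>"
    using le abs_triangle_ineq4[of \<gamma> "\<delta> * s"] abs_triangle_ineq[of "\<alpha> - \<beta> * s" "\<beta> * s"] by simp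
  moreover have "\<bar>\<alpha> + \<beta> * s\<bar> + \<bar>\<alpha> - \<beta> * s\<bar> = 2 * \<bar>\<alpha>\<bar>"
    using le by (intro abs_add_abs_diff) simp
  ultimately have "(max \<bar>\<alpha> + \<beta> * s\<bar> \<bar>\<gamma> + \<delta> * s\<bar>) + (max \<bar>\<alpha> - \<beta> * s\<bar> \<bar>\<gamma> - \<delta> * s\<bar>) = 2 * (max \<bar>\<alpha>\<bar> \<bar>\<gamma>\<bar>)"
    using lt by (simp only: max_absorb1 less_imp_le)
  moreover have "N (x + s *\<^sub>R y) = max \<bar>\<alpha> + \<beta> * s\<bar> \<bar>\<gamma> + \<delta> * s\<bar>"
    "N (x - s *\<^sub>R y) = max \<bar>\<alpha> - \<beta> * s\<bar> \<bar>\<gamma> - \<delta> * s\<bar>" "N x = max \<bar>\<alpha>\<bar> \<bar>\<gamma>\<bar>"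
    subgoal using N[of 1 s] by simp
    subgoal using N[of 1 "- s"] by simp
    subgoal using N[of 1 0] by simp
    done
  ultimately show ?thesis using s by (intro exI[of _ s] conjI) (simp_all only:)
qed

text \<open>A kink excludes a dominant form, so up to sign both forms take the value
  \<open>N x\<close> at \<open>x\<close>. The maximum of \<open>\<bar>A + B\<bar>\<close> and
  \<open>\<bar>A - B\<bar>\<close> is then \<open>\<bar>A\<bar> + \<bar>B\<bar>\<close>.\<close>

lemma parallelogram_vertex:
  fixes N :: "'v::real_vector \<Rightarrow> real"
  assumes N: "\<exists>\<alpha> \<beta> \<gamma> \<delta>. \<forall>a b. N (a *\<^sub>R x + b *\<^sub>R y) = max \<bar>\<alpha> * a + \<beta> * b\<bar> \<bar>\<gamma> * a + \<delta> * b\<bar>"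
    and pos: "0 < N x"
    and kink: "\<And>s. 0 < s \<Longrightarrow> 2 * N x < N (x + s *\<^sub>R y) + N (x - s *\<^sub>R y)"
  shows "\<exists>c \<kappa>. \<forall>a b. N (a *\<^sub>R x + b *\<^sub>R y) = N x * \<bar>a - c * b\<bar> + \<kappa> * \<bar>b\<bar>"
proof -
  obtain \<alpha> \<beta> \<gamma> \<delta> where N: "\<And>a b. N (a *\<^sub>R x + b *\<^sub>R y) = max \<bar>\<alpha> * a + \<beta> * b\<bar> \<bar>\<gamma> * a + \<delta> * b\<bar>"
    using N by blast
  have N': "N (a *\<^sub>R x + b *\<^sub>R y) = max \<bar>\<gamma> * a + \<delta> * b\<bar> \<bar>\<alpha> * a + \<beta> * b\<bar>" for a b
    unfolding N by (rule max.commute)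
  have "\<not> \<bar>\<gamma>\<bar> < \<bar>\<alpha>\<bar>" using parallelogram_edge_affine[of N x y, OF N] kink by force
  moreover have "\<not> \<bar>\<alpha>\<bar> < \<bar>\<gamma>\<bar>" using parallelogram_edge_affine[of N x y, OF N'] kink by force
  ultimately have eq: "\<bar>\<alpha>\<bar> = N x" "\<bar>\<gamma>\<bar> = N x" using N[of 1 0] by auto
  have flip: "\<exists>v'. \<forall>a b. \<bar>u * a + v * b\<bar> = \<bar>N x * a + v' * b\<bar>" if "\<bar>u\<bar> = N x" for u v
  proof (cases "0 \<le> u")
    case False
    then have "u = - N x" using that by simp
    then have "N x * a + (- v) * b = - (u * a + v * b)" for a b by simp
    then have "\<bar>u * a + v * b\<bar> = \<bar>N x * a + (- v) * b\<bar>" for a b by simp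
    then show ?thesis by blast
  qed (use that in auto)
  obtain \<beta>' where b: "\<And>a b. \<bar>\<alpha> * a + \<beta> * b\<bar> = \<bar>N x * a + \<beta>' * b\<bar>" using flip[OF eq(1)] by blast
  obtain \<delta>' where d: "\<And>a b. \<bar>\<gamma> * a + \<delta> * b\<bar> = \<bar>N x * a + \<delta>' * b\<bar>" using flip[OF eq(2)] by blast
  define c \<kappa> where "c = - (\<beta>' + \<delta>') / (2 * N x)" and "\<kappa> = \<bar>\<beta>' - \<delta>'\<bar> / 2"
  have "N (a *\<^sub>R x + b *\<^sub>R y) = N x * \<bar>a - c * b\<bar> + \<kappa> * \<bar>b\<bar>" for a b
  proof -
    define A B where "A = N x * (a - c * b)" and "B = (\<beta>' - \<delta>') / 2 * b"
    have "N x * a + \<beta>' * b = A + B" "N x * a + \<delta>' * b = A - B"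
      using pos by (simp_all add: A_def B_def c_def field_simps)
    then have "N (a *\<^sub>R x + b *\<^sub>R y) = \<bar>A\<bar> + \<bar>B\<bar>" unfolding N b d by (simp add: max_abs_add_diff)
    then show ?thesis using pos by (simp add: A_def B_def \<kappa>_def abs_mult)
  qed
  then show ?thesis by blast
qed

section \<open>The slope function at a vertex common to all sections through it\<close>

locale parallelogram_sections =
  fixes N :: "'v::real_vector \<Rightarrow> real"
  assumes pos: "x \<noteq> 0 \<Longrightarrow> 0 < N x"
    and scale: "N (c *\<^sub>R x) = \<bar>c\<bar> * N x"
    and triangle: "N (x + y) \<le> N x + N y"
    and plane: "\<exists>\<alpha> \<beta> \<gamma> \<delta>. \<forall>a b. N (a *\<^sub>R x + b *\<^sub>R y) = max \<bar>\<alpha> * a + \<beta> * b\<bar> \<bar>\<gamma> * a + \<delta> * b\<bar>"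
begin

lemma N_minus: "N (- x) = N x"
  using scale[of "- 1" x] by simp

lemma N_nonneg: "0 \<le> N x"
  using triangle[of x "- x"] N_minus[of x] scale[of 0 x] by simp

lemma triangle_minus: "N y - N x \<le> N (x + y)"
  using triangle[of "x + y" "- x"] N_minus[of x] by simp

end

text \<open>Since \<open>kink\<close> holds in every direction off the line of \<open>e\<close>, the
  point \<open>e\<close> is a vertex of each planar section through it.\<close>

locale parallelogram_sections_vertex = parallelogram_sections N
  for N :: "'v::real_vector \<Rightarrow> real" +
  fixes e :: 'v
  assumes unit: "N e = 1"
    and kink: "y \<notin> span {e} \<Longrightarrow> 2 < N (e + y) + N (e - y)"
begin

text \<open>In the plane of \<open>e\<close> and \<open>y\<close> the norm splits by
  \<open>parallelogram_vertex\<close>; the line through \<open>y\<close> along \<open>e\<close> is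
  closest to the origin at \<open>t = - \<tau>\<close>.\<close>

lemma suspension: "\<exists>\<tau> \<rho>. \<rho> \<ge> 0 \<and> (\<forall>t. N (y + t *\<^sub>R e) = \<rho> + \<bar>t + \<tau>\<bar>)"
proof (cases "y \<in> span {e}")
  case True
  then obtain c where "y = c *\<^sub>R e" by (auto simp: span_singleton)
  then have "N (y + t *\<^sub>R e) = 0 + \<bar>t + c\<bar>" for t
    using scale[of "c + t" e] unit by (simp add: scaleR_add_left add.commute)
  then show ?thesis by blast
next
  case False
  have "s *\<^sub>R y \<notin> span {e}" if "0 < s" for s
  proof
    assume "s *\<^sub>R y \<in> span {e}"
    then have "inverse s *\<^sub>R (s *\<^sub>R y) \<in> span {e}" by (rule span_scale)
    then show False using that False by simp
  qed
  then obtain c \<kappa> where N: "\<And>a b. N (a *\<^sub>R e + b *\<^sub>R y) = N e * \<bar>a - c * b\<bar> + \<kappa> * \<bar>b\<bar>"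
    using parallelogram_vertex[OF plane[of e y]] kink unit by (auto simp: that)
  have eq: "N (y + t *\<^sub>R e) = \<kappa> + \<bar>t + (- c)\<bar>" for t
    using N[of t 1] unit by (simp add: add.commute)
  moreover have "0 \<le> \<kappa>" using eq[of c] N_nonneg[of "y + c *\<^sub>R e"] by simp
  ultimately show ?thesis by blast
qed

text \<open>The one-sided derivative of \<open>N\<close> at \<open>e\<close> in direction \<open>x\<close>.  By the suspension structure
  the difference quotient is already stationary at the step \<open>1 / N x\<close>.\<close>

definition slope :: "'v \<Rightarrow> real"
  where "slope x = N (x + N x *\<^sub>R e) - N x"

text \<open>From \<open>N x = \<rho> + \<bar>\<tau>\<bar>\<close> the turning point
  \<open>- \<tau>\<close> is at most \<open>N x\<close>, and beyond it \<open>N\<close> grows with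
  rate one along \<open>e\<close>.\<close>

lemma slope_eq:
  assumes "N x \<le> M"
  shows "N (x + M *\<^sub>R e) = M + slope x"
proof -
  obtain \<tau> \<rho> where \<rho>: "\<rho> \<ge> 0" "\<And>t. N (x + t *\<^sub>R e) = \<rho> + \<bar>t + \<tau>\<bar>"
    using suspension[of x] by blast
  have "- \<tau> \<le> N x" using \<rho>(1) \<rho>(2)[of 0] by simp
  then show ?thesis using assms \<rho>(2)[of M] \<rho>(2)[of "N x"] by (simp add: slope_def)
qed

lemma slope_add_e: "slope (x + t *\<^sub>R e) = slope x + t"
proof -
  define M where "M = N (x + t *\<^sub>R e) + N x + \<bar>t\<bar>"
  have M: "N (x + t *\<^sub>R e) \<le> M" "N x \<le> M + t"
    using N_nonneg[of x] N_nonneg[of "x + t *\<^sub>R e"] by (auto simp: M_def)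
  show ?thesis
    using slope_eq[OF M(1)] slope_eq[OF M(2)] by (simp add: scaleR_add_left add.commute add.left_commute)
qed

lemma slope_scale:
  assumes "0 < c"
  shows "slope (c *\<^sub>R x) = c * slope x"
  using slope_eq[of "c *\<^sub>R x" "c * N x"] slope_eq[of x "N x"] scale[of c "x + N x *\<^sub>R e"] scale[of c x] assms
  by (simp add: scaleR_add_right algebra_simps)

text \<open>On each line parallel to \<open>e\<close> this selects the point of least
  \<open>N\<close>. Nothing makes it a subspace in advance, so vectors are moved into it one at a
  time.\<close>

definition equator :: "'v set"
  where "equator = {x. \<forall>t. N (x + t *\<^sub>R e) = N x + \<bar>t\<bar>}"

lemma equatorD: "x \<in> equator \<Longrightarrow> N (x + t *\<^sub>R e) = N x + \<bar>t\<bar>"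
  by (simp add: equator_def)

lemma shift_to_equator: "\<exists>t. x + t *\<^sub>R e \<in> equator"
proof -
  obtain \<tau> \<rho> where \<rho>: "\<rho> \<ge> 0" "\<And>t. N (x + t *\<^sub>R e) = \<rho> + \<bar>t + \<tau>\<bar>"
    using suspension[of x] by blast
  have "N (x + (- \<tau>) *\<^sub>R e + t *\<^sub>R e) = \<rho> + \<bar>t\<bar>" for t
    using \<rho>(2)[of "t - \<tau>"] by (simp add: algebra_simps)
  moreover from this[of 0] have "N (x + (- \<tau>) *\<^sub>R e) = \<rho>" by simp
  ultimately have "x + (- \<tau>) *\<^sub>R e \<in> equator" by (simp add: equator_def)
  then show ?thesis by blast
qed

text \<open>The plane spanned by \<open>x + L e\<close> and \<open>d\<close> has a vertex at \<open>d\<close>, so its section is a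
  parallelogram with only one further pair of vertices.\<close>

lemma slope_line:
  assumes d: "d \<in> equator" "d \<noteq> 0"
  obtains c where "\<And>s. \<bar>s\<bar> \<le> R \<or> \<bar>s - c\<bar> \<le> R \<Longrightarrow>
    slope (x + s *\<^sub>R d) = slope (x + c *\<^sub>R d) + \<bar>s - c\<bar> * N d"
proof -
  have Nd: "0 < N d" using d pos by blast
  \<comment> \<open>\<open>L\<close> exceeds \<open>N x\<close>, which produces the kink at
    \<open>d\<close>, and is large enough for \<open>slope_eq\<close> at all points
    \<open>x + s *\<^sub>R d\<close> considered below.\<close>
  define L where "L = 2 * N x + \<bar>R\<bar> * N d + 1"
  have L: "N x < L" "0 < L"
    using N_nonneg[of x] Nd by (simp_all add: L_def add_nonneg_pos)
  define y where "y = x + L *\<^sub>R e"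
  have low: "N d + \<bar>s\<bar> * (L - N x) \<le> N (d + s *\<^sub>R y)" for s
    using triangle_minus[of "d + (s * L) *\<^sub>R e" "s *\<^sub>R x"] scale[of s x] equatorD[OF d(1), of "s * L"] L
    by (simp add: y_def scaleR_add_right abs_mult algebra_simps)
  have "2 * N d < N (d + s *\<^sub>R y) + N (d - s *\<^sub>R y)" if "0 < s" for s
  proof -
    have "0 < s * (L - N x)" using that L by simp
    then show ?thesis using low[of s] low[of "- s"] that by simp
  qed
  then obtain c \<kappa> where N: "\<And>a b. N (a *\<^sub>R d + b *\<^sub>R y) = N d * \<bar>a - c * b\<bar> + \<kappa> * \<bar>b\<bar>"
    using parallelogram_vertex[OF plane[of d y] Nd] by blast
  have line: "N (y + s *\<^sub>R d) = N d * \<bar>s - c\<bar> + \<kappa>" for s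
    using N[of s 1] by (simp add: add.commute)
  \<comment> \<open>Comparing the heights at \<open>0\<close> and \<open>c\<close> gives
    \<open>\<bar>c\<bar> * N d \<le> N x\<close>, so that \<open>L\<close>, chosen before
    \<open>c\<close>, also suffices near \<open>c\<close>.\<close>
  have "N (c *\<^sub>R d + L *\<^sub>R e) = \<bar>c\<bar> * N d + L"
  proof (cases "c = 0")
    case False
    have "N (c *\<^sub>R (d + (L / c) *\<^sub>R e)) = \<bar>c\<bar> * (N d + \<bar>L / c\<bar>)"
      unfolding scale equatorD[OF d(1)] ..
    then show ?thesis using False L by (simp add: scaleR_add_right abs_mult algebra_simps)
  qed (use scale[of L e] unit L in simp)
  then have "\<bar>c\<bar> * N d + L - N x \<le> N (y + c *\<^sub>R d)"
    using triangle_minus[of "c *\<^sub>R d + L *\<^sub>R e" x] by (simp add: y_def algebra_simps)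
  moreover have "N y \<le> N x + L"
    using triangle[of x "L *\<^sub>R e"] scale[of L e] unit L by (simp add: y_def)
  ultimately have cb: "\<bar>c\<bar> * N d \<le> N x" using line[of 0] line[of c] by (simp add: algebra_simps)
  \<comment> \<open>The bound \<open>\<bar>R\<bar>\<close> admits \<open>s = c\<close> whatever the
    sign of \<open>R\<close>.\<close>
  have sl: "slope (x + s *\<^sub>R d) = N (y + s *\<^sub>R d) - L" if "\<bar>s\<bar> \<le> R \<or> \<bar>s - c\<bar> \<le> \<bar>R\<bar>" for s
  proof -
    have "\<bar>s\<bar> * N d \<le> (\<bar>c\<bar> + \<bar>R\<bar>) * N d" using that Nd by (intro mult_right_mono) auto
    then have "N (x + s *\<^sub>R d) \<le> L"
      using triangle[of x "s *\<^sub>R d"] scale[of s d] cb by (simp add: L_def algebra_simps)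
    from slope_eq[OF this] show ?thesis by (simp add: y_def algebra_simps)
  qed
  show thesis
  proof (rule that)
    fix s assume "\<bar>s\<bar> \<le> R \<or> \<bar>s - c\<bar> \<le> R"
    then show "slope (x + s *\<^sub>R d) = slope (x + c *\<^sub>R d) + \<bar>s - c\<bar> * N d"
      using sl[of s] sl[of c] line[of s] line[of c] by auto
  qed
qed

text \<open>Two kinks of the slope function can be joined by a line on which, by
  \<open>slope_line\<close>, there is only one.\<close>

lemma dependent: "b\<^sub>2 \<in> span {e} \<or> b\<^sub>1 \<in> span {e, b\<^sub>2}"
proof (rule ccontr)
  assume "\<not> ?thesis"
  then have ind: "b\<^sub>2 \<notin> span {e}" "b\<^sub>1 \<notin> span {e, b\<^sub>2}" by auto
  obtain t\<^sub>2 where "b\<^sub>2 + t\<^sub>2 *\<^sub>R e \<in> equator" using shift_to_equator by blast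
  define w where "w = b\<^sub>2 + t\<^sub>2 *\<^sub>R e"
  have w: "w \<in> equator" unfolding w_def by fact
  have in2: "\<alpha> *\<^sub>R w + \<beta> *\<^sub>R e \<in> span {e, b\<^sub>2}" for \<alpha> \<beta>
    unfolding w_def by (intro span_add span_scale span_base) auto
  have wne: "w + t *\<^sub>R e \<noteq> 0" for t
  proof
    assume "w + t *\<^sub>R e = 0"
    then have "b\<^sub>2 + (t\<^sub>2 + t) *\<^sub>R e = 0" by (simp add: w_def scaleR_add_left add.assoc)
    then have "b\<^sub>2 = - ((t\<^sub>2 + t) *\<^sub>R e)" by (simp only: eq_neg_iff_add_eq_0)
    then show False using ind(1) by (metis span_base span_scale span_neg singletonI)
  qed
  have w0: "w \<noteq> 0" using wne[of 0] by simp
  \<comment> \<open>Moving \<open>b\<^sub>1\<close> along \<open>w\<close> to the kink and then onto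
    the equator gives \<open>z\<close>; by \<open>slope_add_e\<close> the last shift preserves the
    kink along \<open>w\<close>.\<close>
  obtain c where c: "\<And>s. \<bar>s\<bar> \<le> 1 \<or> \<bar>s - c\<bar> \<le> 1 \<Longrightarrow>
      slope (b\<^sub>1 + s *\<^sub>R w) = slope (b\<^sub>1 + c *\<^sub>R w) + \<bar>s - c\<bar> * N w"
    using slope_line[OF w w0] by blast
  obtain t where t: "b\<^sub>1 + c *\<^sub>R w + t *\<^sub>R e \<in> equator" using shift_to_equator by blast
  define z where "z = b\<^sub>1 + c *\<^sub>R w + t *\<^sub>R e"
  have z: "z \<in> equator" unfolding z_def by fact
  have zne: "z \<noteq> \<alpha> *\<^sub>R w + \<beta> *\<^sub>R e" for \<alpha> \<beta>
  proof
    assume "z = \<alpha> *\<^sub>R w + \<beta> *\<^sub>R e"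
    then have "b\<^sub>1 = (\<alpha> - c) *\<^sub>R w + (\<beta> - t) *\<^sub>R e" by (simp add: z_def algebra_simps)
    then show False using in2 ind(2) by metis
  qed
  have z0: "z \<noteq> 0" using zne[of 0 0] by simp
  have kink_z: "slope (z + s *\<^sub>R w) = slope z + \<bar>s\<bar> * N w" if "\<bar>s\<bar> \<le> 1" for s
  proof -
    have "slope (z + s *\<^sub>R w) = slope (b\<^sub>1 + (c + s) *\<^sub>R w + t *\<^sub>R e)"
      by (simp add: z_def algebra_simps)
    also have "\<dots> = slope z + \<bar>s\<bar> * N w"
      using c[of "c + s"] that by (simp add: slope_add_e z_def)
    finally show ?thesis .
  qed
  \<comment> \<open>The same with the roles exchanged: \<open>z'\<close> is the kink on the line
    through \<open>w\<close> along \<open>z\<close>.\<close>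
  obtain c' where c': "\<And>s. \<bar>s\<bar> \<le> 1 \<or> \<bar>s - c'\<bar> \<le> 1 \<Longrightarrow>
      slope (w + s *\<^sub>R z) = slope (w + c' *\<^sub>R z) + \<bar>s - c'\<bar> * N z"
    using slope_line[OF z z0] by blast
  define z' where "z' = w + c' *\<^sub>R z"
  have kink_z': "slope (z' + s *\<^sub>R z) = slope z' + \<bar>s\<bar> * N z" if "\<bar>s\<bar> \<le> 1" for s
    using c'[of "c' + s"] that by (simp add: z'_def algebra_simps)
  obtain t' where t': "z' - z + t' *\<^sub>R e \<in> equator" using shift_to_equator by blast
  \<comment> \<open>Up to a multiple of \<open>e\<close>, \<open>d\<close> points from
    \<open>z\<close> to \<open>z'\<close>, so the line \<open>z + s *\<^sub>R d\<close> should have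
    kinks at both \<open>s = 0\<close> and \<open>s = 1\<close>.\<close>
  define d where "d = z' - z + t' *\<^sub>R e"
  define k where "k = c' - 1"
  have d_eq: "d = w + k *\<^sub>R z + t' *\<^sub>R e" by (simp add: d_def z'_def k_def algebra_simps)
  have "d \<noteq> 0"
  proof
    assume d0: "d = 0"
    show False
    proof (cases "k = 0")
      case False
      have "k *\<^sub>R z = - w - t' *\<^sub>R e" using d0 by (simp add: d_eq algebra_simps eq_neg_iff_add_eq_0)
      then have "inverse k *\<^sub>R (k *\<^sub>R z) = inverse k *\<^sub>R (- w - t' *\<^sub>R e)" by simp
      then have "z = (- inverse k) *\<^sub>R w + (- inverse k * t') *\<^sub>R e"
        using False by (simp add: algebra_simps)
      then show False using zne by blast
    qed (use d0 wne in \<open>simp add: d_eq\<close>)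
  qed
  then obtain u where u: "\<And>s. \<bar>s\<bar> \<le> 2 \<or> \<bar>s - u\<bar> \<le> 2 \<Longrightarrow>
      slope (z + s *\<^sub>R d) = slope (z + u *\<^sub>R d) + \<bar>s - u\<bar> * N d"
    using slope_line[of d 2 z] t' unfolding d_def by blast
  have affine: "slope (z + (a + h) *\<^sub>R d) + slope (z + (a - h) *\<^sub>R d) = 2 * slope (z + a *\<^sub>R d)"
    if "\<bar>a\<bar> \<le> 1" "0 \<le> h" "h \<le> 1" "h \<le> \<bar>a - u\<bar>" for a h
  proof -
    have "\<bar>a + h - u\<bar> + \<bar>a - h - u\<bar> = 2 * \<bar>a - u\<bar>"
      using abs_add_abs_diff[of h "a - u"] that by (simp add: algebra_simps)
    then have "\<bar>a + h - u\<bar> * N d + \<bar>a - h - u\<bar> * N d = 2 * (\<bar>a - u\<bar> * N d)"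
      by (metis distrib_right mult.assoc)
    moreover have "\<bar>a + h\<bar> \<le> 2" "\<bar>a - h\<bar> \<le> 2" "\<bar>a\<bar> \<le> 2" using that by linarith+
    ultimately show ?thesis using u[of "a + h"] u[of "a - h"] u[of a] by simp
  qed
  \<comment> \<open>Modulo \<open>z\<close> and \<open>e\<close> the direction \<open>d\<close> is
    \<open>w\<close>. Positive homogeneity and \<open>slope_add_e\<close> absorb the other parts, so
    the kink along \<open>w\<close> shows at \<open>s = 0\<close>.\<close>
  have "u = 0"
  proof (rule ccontr)
    assume "u \<noteq> 0"
    \<comment> \<open>The first bound is for \<open>affine\<close>; the second keeps
      \<open>m\<close> at least \<open>1 / 2\<close> and \<open>h / m\<close> at most one, within
      the range of \<open>kink_z\<close>.\<close>
    define h where "h = min \<bar>u\<bar> (1 / (2 * (\<bar>k\<bar> + 1)))"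
    have h: "0 < h" "h \<le> \<bar>u\<bar>" using \<open>u \<noteq> 0\<close> by (auto simp: h_def add_nonneg_pos)
    have "h * (\<bar>k\<bar> + 1) \<le> 1 / (2 * (\<bar>k\<bar> + 1)) * (\<bar>k\<bar> + 1)"
      by (intro mult_right_mono) (auto simp: h_def)
    also have "\<dots> = 1 / 2" by (simp add: add_nonneg_pos order_less_imp_not_eq2)
    finally have hk: "\<bar>h * k\<bar> + h \<le> 1 / 2" using h by (simp add: abs_mult algebra_simps)
    have side: "slope (z + (\<sigma> * h) *\<^sub>R d) = (1 + \<sigma> * h * k) * slope z + h * N w + \<sigma> * h * t'"
      if "\<bar>\<sigma>\<bar> = 1" for \<sigma>
    proof -
      define m where "m = 1 + \<sigma> * h * k"
      have "\<bar>\<sigma> * (h * k)\<bar> = \<bar>h * k\<bar>" using that by (simp add: abs_mult)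
      then have m: "1 / 2 \<le> m" "h \<le> m" "0 < m" using hk h by (auto simp: m_def mult.assoc)
      have "z + (\<sigma> * h) *\<^sub>R d = (m *\<^sub>R z + (\<sigma> * h) *\<^sub>R w) + (\<sigma> * h * t') *\<^sub>R e"
        by (simp add: d_eq m_def algebra_simps)
      also have "m *\<^sub>R z + (\<sigma> * h) *\<^sub>R w = m *\<^sub>R (z + (\<sigma> * h / m) *\<^sub>R w)"
        using m by (simp add: scaleR_add_right)
      finally have "slope (z + (\<sigma> * h) *\<^sub>R d) = m * slope (z + (\<sigma> * h / m) *\<^sub>R w) + \<sigma> * h * t'"
        using slope_scale[OF m(3)] by (simp add: slope_add_e)
      also have "slope (z + (\<sigma> * h / m) *\<^sub>R w) = slope z + h / m * N w"
        using kink_z[of "\<sigma> * h / m"] that m h by (simp add: abs_mult)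
      finally show ?thesis using m by (simp add: m_def[symmetric] distrib_left)
    qed
    have "slope (z + h *\<^sub>R d) + slope (z + (- h) *\<^sub>R d) = 2 * slope z + 2 * (h * N w)"
      using side[of 1] side[of "- 1"] by (simp add: algebra_simps)
    moreover have "0 < h * N w" using h w0 pos by simp
    ultimately show False using affine[of 0 h] h hk by simp
  qed
  \<comment> \<open>Modulo \<open>z'\<close> and \<open>e\<close> the direction \<open>d\<close> is
    \<open>- z\<close>, along which the slope has a kink at \<open>z'\<close>.\<close>
  moreover have "u = 1"
  proof (rule ccontr)
    assume "u \<noteq> 1"
    define h where "h = min \<bar>1 - u\<bar> (1 / 2)"
    have h: "0 < h" "h \<le> \<bar>1 - u\<bar>" "h \<le> 1 / 2" using \<open>u \<noteq> 1\<close> unfolding h_def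
      by (simp, intro min.cobounded1, intro min.cobounded2)
    have side: "slope (z + (1 + \<sigma> * h) *\<^sub>R d) = (1 + \<sigma> * h) * (slope z' + t') + h * N z"
      if "\<bar>\<sigma>\<bar> = 1" for \<sigma>
    proof -
      define m where "m = 1 + \<sigma> * h"
      have "\<bar>\<sigma> * h\<bar> = h" using that h by (simp add: abs_mult)
      then have m: "1 / 2 \<le> m" "h \<le> m" "0 < m" using h by (auto simp: m_def)
      have "z + m *\<^sub>R d = (m *\<^sub>R z' + (- (\<sigma> * h)) *\<^sub>R z) + (m * t') *\<^sub>R e"
        by (simp add: d_def m_def algebra_simps)
      also have "m *\<^sub>R z' + (- (\<sigma> * h)) *\<^sub>R z = m *\<^sub>R (z' + (- (\<sigma> * h / m)) *\<^sub>R z)"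
        using m by (simp add: scaleR_add_right scaleR_diff_right)
      finally have "slope (z + m *\<^sub>R d) = m * slope (z' + (- (\<sigma> * h / m)) *\<^sub>R z) + m * t'"
        using slope_scale[OF m(3)] by (simp add: slope_add_e)
      also have "slope (z' + (- (\<sigma> * h / m)) *\<^sub>R z) = slope z' + h / m * N z"
        using kink_z'[of "- (\<sigma> * h / m)"] that m h by (simp add: abs_mult)
      finally show ?thesis using m by (simp add: m_def[symmetric] distrib_left)
    qed
    have "z + 1 *\<^sub>R d = z' + t' *\<^sub>R e" by (simp add: d_def)
    then have "slope (z + 1 *\<^sub>R d) = slope z' + t'" using slope_add_e by simp
    moreover have "slope (z + (1 + h) *\<^sub>R d) + slope (z + (1 - h) *\<^sub>R d) = 2 * (slope z' + t') + 2 * (h * N z)"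
      using side[of 1] side[of "- 1"] by (simp add: algebra_simps)
    moreover have "0 < h * N z" using h z0 pos by simp
    ultimately show False using affine[of 1 h] h by simp
  qed
  ultimately show False by simp
qed

end

section \<open>Classification\<close>

text \<open>Pulling the norm back to three real coordinates supplies a Euclidean norm, which locates
  the vertex \<open>e\<close>; counting dimensions then contradicts
  \<open>dependent\<close>.\<close>

theorem two_summing_not_independent_three:
  fixes x y z :: "'a::banach"
  assumes two: "two_summing_property TYPE('a)"
    and ind: "independent {x, y, z}" "x \<noteq> y" "x \<noteq> z" "y \<noteq> z"
  shows False
proof -
  define W where "W = (\<lambda>v :: real \<times> real \<times> real. fst v *\<^sub>R x + fst (snd v) *\<^sub>R y + snd (snd v) *\<^sub>R z)"
  have W: "linear W" by (intro linearI) (simp_all add: W_def algebra_simps)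
  have inj: "v = 0" if "W v = 0" for v
  proof -
    define c where "c = (\<lambda>u. if u = x then fst v else if u = y then fst (snd v) else snd (snd v))"
    have "(\<Sum>u\<in>{x, y, z}. c u *\<^sub>R u) = 0" using that ind(2-4) by (simp add: c_def W_def add.assoc)
    then have "c u = 0" if "u \<in> {x, y, z}" for u
      using independentD[OF ind(1), of "{x, y, z}" c u] that by blast
    from this[of x] this[of y] this[of z] show ?thesis
      using ind(2-4) by (simp add: c_def prod_eq_iff)
  qed
  define N where "N = (\<lambda>v. norm (W v))"
  obtain u where u: "norm u = 1" "0 < N u" "\<And>v. N u * norm v \<le> N v"
    using linear_injective_attains_min[OF W inj] unfolding N_def by blast
  define e where "e = inverse (N u) *\<^sub>R u"
  have e: "N u * norm e = 1" "e \<noteq> 0" using u by (auto simp: e_def)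
  \<comment> \<open>\<open>e\<close> is the point of the unit ball farthest from the origin in the Euclidean norm, so strict
    convexity of the Euclidean ball gives the kink.\<close>
  interpret parallelogram_sections_vertex N e
  proof
    show "0 < N v" if "v \<noteq> 0" for v using inj[of v] that unfolding N_def by force
    show "N (c *\<^sub>R v) = \<bar>c\<bar> * N v" for c v by (simp add: N_def linear_cmul[OF W])
    show "N (v + w) \<le> N v + N w" for v w by (simp add: N_def linear_add[OF W] norm_triangle_ineq)
    show "\<exists>\<alpha> \<beta> \<gamma> \<delta>. \<forall>a b. N (a *\<^sub>R v + b *\<^sub>R w) = max \<bar>\<alpha> * a + \<beta> * b\<bar> \<bar>\<gamma> * a + \<delta> * b\<bar>" for v w
      unfolding N_def linear_add[OF W] linear_cmul[OF W] by (rule two_summing_plane_section[OF two])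
    show "N e = 1" using u(2) by (simp add: N_def e_def linear_cmul[OF W])
    fix y assume y: "y \<notin> span {e}"
    have "norm (e + y) + norm (e - y) \<noteq> norm ((e + y) + (e - y))"
    proof
      assume eq: "norm (e + y) + norm (e - y) = norm ((e + y) + (e - y))"
      define p q where "p = norm (e + y)" and "q = norm (e - y)"
      have "p *\<^sub>R (e - y) = q *\<^sub>R (e + y)"
        using eq norm_triangle_eq[of "e + y" "e - y"] by (simp add: p_def q_def)
      then have par: "(p + q) *\<^sub>R y = (p - q) *\<^sub>R e" by (simp add: algebra_simps)
      have "p + q = norm (2 *\<^sub>R e)" using eq by (simp add: p_def q_def scaleR_2)
      then have "p + q \<noteq> 0" using e by simp
      then have "y = inverse (p + q) *\<^sub>R ((p + q) *\<^sub>R y)" by simp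
      then have "y \<in> span {e}" unfolding par by (metis span_base span_scale singletonI)
      then show False using y by simp
    qed
    moreover have "(e + y) + (e - y) = 2 *\<^sub>R e" by (simp add: scaleR_2)
    ultimately have "2 * norm e < norm (e + y) + norm (e - y)"
      using norm_triangle_ineq[of "e + y" "e - y"] by simp
    then have "N u * (2 * norm e) < N u * (norm (e + y) + norm (e - y))" using u(2) by simp
    also have "\<dots> \<le> N (e + y) + N (e - y)" using u(3)[of "e + y"] u(3)[of "e - y"] by (simp add: distrib_left)
    finally show "2 < N (e + y) + N (e - y)" using e(1) by simp
  qed
  have not_span: "\<exists>v. v \<notin> span S" if "finite S" "card S \<le> 2" for S :: "(real \<times> real \<times> real) set"
  proof (rule ccontr)
    assume "\<not> ?thesis"
    then have "span S = UNIV" by auto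
    then have "dim S = 3" by (metis dim_span dim_UNIV DIM_prod DIM_real numeral_3_eq_3 One_nat_def add_Suc_right Nat.add_0_right)
    then show False using dim_le_card'[OF that(1)] that(2) by simp
  qed
  obtain b\<^sub>2 where "b\<^sub>2 \<notin> span {e}" using not_span[of "{e}"] by auto
  moreover have "card {e, b\<^sub>2} \<le> 2" by (cases "e = b\<^sub>2") simp_all
  then obtain b\<^sub>1 where "b\<^sub>1 \<notin> span {e, b\<^sub>2}" using not_span[of "{e, b\<^sub>2}"] by blast
  ultimately show False using dependent by blast
qed

section \<open>Identification with the line and the max-norm plane\<close>

text \<open>The isometries below are built from coordinates, opposite to the direction in the
  definition; norm preservation makes them invertible.\<close>

lemma isometrically_isomorphicI:
  fixes G :: "'b::real_normed_vector \<Rightarrow> 'a::real_normed_vector"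
  assumes G: "linear G" "surj G" "\<And>p. norm (G p) = norm p"
  shows "isometrically_isomorphic TYPE('a) TYPE('b)"
proof -
  have inj: "inj G"
    unfolding linear_injective_0[OF G(1)] using G(3) by (metis norm_eq_zero)
  have right: "G (inv G x) = x" for x by (rule surj_f_inv_f[OF G(2)])
  have "linear (inv G)"
    by (intro linearI injD[OF inj]) (simp_all add: right linear_add[OF G(1)] linear_cmul[OF G(1)])
  moreover have "surj (inv G)" by (rule inj_imp_surj_inv[OF inj])
  moreover have "norm (inv G x) = norm x" for x using G(3)[of "inv G x"] by (simp add: right)
  ultimately show ?thesis unfolding isometrically_isomorphic_def by blast
qed

lemma two_summing_if_isometric_real:
  assumes "isometrically_isomorphic TYPE('a::banach) TYPE(real)"
  shows "two_summing_property TYPE('a)"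
proof -
  obtain f :: "'a \<Rightarrow> real" where f: "linear f" "surj f" "\<And>x. norm (f x) = norm x"
    using assms unfolding isometrically_isomorphic_def by blast
  have inj: "inj f" unfolding linear_injective_0[OF f(1)] using f(3) by (metis norm_eq_zero)
  obtain p where p: "f p = 1" using f(2) by (metis surjD)
  then have "norm p = 1" using f(3)[of p] by simp
  have "x = f x *\<^sub>R p + 0 *\<^sub>R 0" for x
    by (rule injD[OF inj]) (simp add: p linear_cmul[OF f(1)])
  then show ?thesis
    using f p \<open>norm p = 1\<close>
    by (intro two_summing_if_coordinates[of f "\<lambda>_. 0" p 0]) (auto simp: linear_zero)
qed

lemma two_summing_if_isometric_linf2:
  assumes "isometrically_isomorphic TYPE('a::banach) TYPE(linf2)"
  shows "two_summing_property TYPE('a)"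
proof -
  obtain f :: "'a \<Rightarrow> linf2" where f: "linear f" "surj f" "\<And>x. norm (f x) = norm x"
    using assms unfolding isometrically_isomorphic_def by blast
  have inj: "inj f" unfolding linear_injective_0[OF f(1)] using f(3) by (metis norm_eq_zero)
  define F where "F = (\<lambda>x. pair_of_linf2 (f x))"
  have F: "F (x + y) = F x + F y" "F (c *\<^sub>R x) = c *\<^sub>R F x" for x y c
    by (simp_all add: F_def linear_add[OF f(1)] linear_cmul[OF f(1)] plus_linf2.rep_eq scaleR_linf2.rep_eq)
  have F_minus: "F (x - y) = F x - F y" for x y
    by (simp add: F_def linear_diff[OF f(1)] minus_linf2.rep_eq)
  have normF: "norm x = max \<bar>fst (F x)\<bar> \<bar>snd (F x)\<bar>" for x
    unfolding F_def f(3)[symmetric] by (simp add: norm_linf2.rep_eq case_prod_beta)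
  have injF: "x = y" if "F x = F y" for x y
    using that injD[OF inj] by (simp add: F_def pair_of_linf2_inject)
  obtain p q where pq: "F p = (1, 0)" "F q = (0, 1)"
    using f(2) unfolding F_def by (metis surjD Abs_linf2_inverse UNIV_I)
  show ?thesis
  proof (rule two_summing_if_coordinates[of "\<lambda>x. fst (F x)" "\<lambda>x. snd (F x)" p q])
    show "linear (\<lambda>x. fst (F x))" "linear (\<lambda>x. snd (F x))" by (intro linearI; simp add: F)+
    show "x = fst (F x) *\<^sub>R p + snd (F x) *\<^sub>R q" for x
      by (rule injF) (simp add: F pq)
  qed (simp_all add: normF F F_minus pq)
qed

lemma isometric_real_if_span_singleton:
  fixes x :: "'a::banach"
  assumes "x \<noteq> 0" "\<And>y. y \<in> span {x}"
  shows "isometrically_isomorphic TYPE('a) TYPE(real)"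
proof (rule isometrically_isomorphicI)
  define G where "G = (\<lambda>t. (t / norm x) *\<^sub>R x)"
  show "linear G" by (intro linearI) (simp_all add: G_def add_divide_distrib scaleR_add_left)
  show "norm (G t) = norm t" for t using assms(1) by (simp add: G_def)
  have "\<exists>t. y = G t" for y
  proof -
    obtain c where "y = c *\<^sub>R x" using assms(2)[of y] by (auto simp: span_singleton)
    then have "y = G (c * norm x)" using assms(1) by (simp add: G_def)
    then show ?thesis ..
  qed
  then show "surj G" unfolding surj_def by blast
qed

lemma isometric_linf2_if_span_pair:
  fixes x y :: "'a::banach"
  assumes two: "two_summing_property TYPE('a)"
    and xy: "x \<noteq> 0" "y \<notin> span {x}" "\<And>z. z \<in> span {x, y}"
  shows "isometrically_isomorphic TYPE('a) TYPE(linf2)"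
proof -
  obtain \<alpha> \<beta> \<gamma> \<delta> where N: "\<And>a b. norm (a *\<^sub>R x + b *\<^sub>R y) = max \<bar>\<alpha> * a + \<beta> * b\<bar> \<bar>\<gamma> * a + \<delta> * b\<bar>"
    using two_summing_plane_section[OF two, of x y] by blast
  have ind: "a = 0 \<and> b = 0" if "a *\<^sub>R x + b *\<^sub>R y = 0" for a b
  proof (cases "b = 0")
    case False
    have "y = inverse b *\<^sub>R (b *\<^sub>R y)" using False by simp
    also have "b *\<^sub>R y = (- a) *\<^sub>R x" using that by (simp add: eq_neg_iff_add_eq_0 add.commute)
    finally show ?thesis using xy(2) by (metis span_base span_scale singletonI)
  qed (use that xy(1) in auto)
  define D where "D = \<alpha> * \<delta> - \<beta> * \<gamma>"
  \<comment> \<open>If \<open>D\<close> were zero, the coefficient pairs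
    \<open>(\<delta>, - \<gamma>)\<close> and \<open>(\<beta>, - \<alpha>)\<close> would give
    vectors of norm zero, hence all four coefficients would vanish.\<close>
  have D: "D \<noteq> 0"
  proof
    assume D0: "D = 0"
    have "\<delta> *\<^sub>R x + (- \<gamma>) *\<^sub>R y = 0" "\<beta> *\<^sub>R x + (- \<alpha>) *\<^sub>R y = 0"
      using N[of \<delta> "- \<gamma>"] N[of \<beta> "- \<alpha>"] D0 by (simp_all add: D_def mult.commute)
    from ind[OF this(1)] ind[OF this(2)] show False using N[of 1 0] xy(1) by simp
  qed
  \<comment> \<open>Cramer's rule for the system given by the two linear forms.\<close>
  define G where "G = (\<lambda>p. ((\<delta> * fst (pair_of_linf2 p) - \<beta> * snd (pair_of_linf2 p)) / D) *\<^sub>R x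
      + ((\<alpha> * snd (pair_of_linf2 p) - \<gamma> * fst (pair_of_linf2 p)) / D) *\<^sub>R y)"
  have "linear G"
    by (intro linearI) (simp_all add: G_def plus_linf2.rep_eq scaleR_linf2.rep_eq
        algebra_simps add_divide_distrib diff_divide_distrib)
  moreover have "norm (G p) = norm p" for p
  proof -
    define s t where "s = fst (pair_of_linf2 p)" and "t = snd (pair_of_linf2 p)"
    have "\<alpha> * ((\<delta> * s - \<beta> * t) / D) + \<beta> * ((\<alpha> * t - \<gamma> * s) / D) = D * s / D"
      "\<gamma> * ((\<delta> * s - \<beta> * t) / D) + \<delta> * ((\<alpha> * t - \<gamma> * s) / D) = D * t / D"
      unfolding times_divide_eq_right add_divide_distrib[symmetric] by (simp_all add: D_def algebra_simps)
    then show ?thesis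
      using D by (simp add: G_def N norm_linf2.rep_eq case_prod_beta flip: s_def t_def)
  qed
  moreover have "\<exists>p. z = G p" for z
  proof -
    obtain a b where z: "z = a *\<^sub>R x + b *\<^sub>R y"
      using xy(3)[of z] by (auto simp: span_insert span_singleton algebra_simps) 
    have "(\<delta> * (\<alpha> * a + \<beta> * b) - \<beta> * (\<gamma> * a + \<delta> * b)) / D = a"
      "(\<alpha> * (\<gamma> * a + \<delta> * b) - \<gamma> * (\<alpha> * a + \<beta> * b)) / D = b"
      using D by (simp_all add: D_def field_simps)
    then have "z = G (Abs_linf2 (\<alpha> * a + \<beta> * b, \<gamma> * a + \<delta> * b))"
      by (simp add: z G_def Abs_linf2_inverse)
    then show ?thesis ..
  qed
  then have "surj G" unfolding surj_def by blast
  ultimately show ?thesis by (intro isometrically_isomorphicI)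
qed

text \<open>Three independent vectors express dimension at least three, infinite dimension included.
  Without them one or two vectors span the space, and in the second case the space is its own planar
  section.\<close>

theorem theorem3p3:
  assumes "\<exists>x :: 'a::banach. x \<noteq> 0"
  shows "((\<exists>B :: 'a set. independent B \<and> card B = 3) \<longrightarrow> \<not> two_summing_property TYPE('a)) \<and>
    (two_summing_property TYPE('a) \<longleftrightarrow>
      isometrically_isomorphic TYPE('a) TYPE(real) \<or>
      isometrically_isomorphic TYPE('a) TYPE(linf2))"
proof -
  have no_three: "\<not> two_summing_property TYPE('a)" if "independent B" "card B = 3" for B :: "'a set"
    using that two_summing_not_independent_three unfolding card_3_iff by blast
  have "isometrically_isomorphic TYPE('a) TYPE(real) \<or> isometrically_isomorphic TYPE('a) TYPE(linf2)"
    if two: "two_summing_property TYPE('a)"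
  proof -
    obtain x :: 'a where x: "x \<noteq> 0" using assms by blast
    show ?thesis
    proof (cases "\<exists>y. y \<notin> span {x}")
      case False
      then show ?thesis using isometric_real_if_span_singleton[OF x] by blast
    next
      case True
      then obtain y where y: "y \<notin> span {x}" by blast
      have xy: "independent {y, x}" "y \<noteq> x"
        using x y span_base[of x "{x}"] by (auto simp: independent_insert)
      have "z \<in> span {x, y}" for z
      proof (rule ccontr)
        assume z: "z \<notin> span {x, y}"
        then have "z \<noteq> y" "z \<noteq> x" using span_base[of _ "{x, y}"] by blast+
        moreover from this have "independent {z, y, x}"
          unfolding independent_insert[of z "{y, x}"]
          using z xy(1) by (simp add: insert_commute[of y x])
        ultimately show False using two_summing_not_independent_three[OF two] xy(2) by blast
      qed
      then show ?thesis using isometric_linf2_if_span_pair[OF two x y] by blast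
    qed
  qed
  then show ?thesis
    using no_three two_summing_if_isometric_real two_summing_if_isometric_linf2 by blast
qed

end
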